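(* Let $n\geq 1$, let $M$ be a rooted triangulation with $n+3$ vertices endowed with its minimal Schnyder wood, let $(\gamma,\gamma')$ be its image under the Bernardi–Bonichon map, and let $T$ be its 3-mobile. Then there is a bijection between the positions $r\in\{0,\ldots,n\}$ and the black nodes of $T$ whose blue edge is a leg, which maps each position to a black node of the same type. (Equivalently, in the composed bijection between $\mathcal{I}_n$ and $\mathcal{T}_n$, each position corresponds to a black node of the same type.)
   Context: Tamari intervals: Dyck walks of length $2n$ are words on $\{N,E\}$ with $n$ of each letter whose every prefix has at least as many $N$ as $E$. A walk $\gamma'$ is above $\gamma$ if same endpoint and no East step of $\gamma$ lies strictly above the East step of $\gamma'$ in the same column (steps $N=(0,1)$, $E=(1,0)$ from $(0,0)$). The Tamari lattice $\mathrm{Tam}_n$ is $\mathrm{Tam}(\nu)$ for $\nu=(NE)^n$, where for a walk $\nu$ ending at $(i,j)$, $\mathrm{Tam}(\nu)$ is the order on walks above $\nu$ generated as follows: for $\gamma$ above $\nu$ and a point $p=(x,y)$ on $\gamma$, let $x'$ be the abscissa of the North step of $\nu$ from ordinate $y$ to $y+1$ ($x'=i$ if $y=j$), $\ell(p)=x'-x$; if $p$ is preceded by $E$ and followed by $N$, let $p'$ be the next point after $p$ with $\ell(p')=\ell(p)$ and $\mathrm{push}_p(\gamma)$ the walk obtained by moving the $E$ preceding $p$ to just after $p'$; the order is the reflexive-transitive closure of $\gamma\leq\mathrm{push}_p(\gamma)$. $\mathcal{I}_n$ is the set of intervals $(\gamma,\gamma')$, $\gamma\leq\gamma'$ in $\mathrm{Tam}_n$.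 For a Dyck walk $\gamma=E^{\alpha_0}NE^{\alpha_1}\cdots NE^{\alpha_n}$, its canopy word is $\mathrm{can}(\gamma)=w_0\cdots w_n$ with $w_r=E$ if $\alpha_r=0$ and $w_r=N$ if $\alpha_r\geq1$. For $(\gamma,\gamma')\in\mathcal{I}_n$ and $r\in\{0,\dots,n\}$, position $r$ has type $\binom{d}{c}$ if $\mathrm{can}(\gamma)$ has letter $c$ and $\mathrm{can}(\gamma')$ has letter $d$ at position $r$; the possible types are $\binom{N}{N},\binom{E}{N},\binom{E}{E}$. Schnyder woods: a rooted triangulation is a simple planar map with all faces of degree 3 and a root corner in the outer face; its outer vertices are $u_B,u_G,u_R$ in clockwise order, $u_B$ incident to the root corner. A Schnyder wood is an orientation and coloring (blue, green, red) of the inner edges such that edges incident to $u_B$ (resp. $u_G$, $u_R$) are ingoing there and blue (resp. green, red), and every inner vertex has exactly one outgoing edge of each color, the edges around it being in clockwise order: outgoing blue, ingoing reds, outgoing green, ingoing blues, outgoing red, ingoing greens (each group of ingoing edges possibly empty). It is minimal if it has no clockwise directed cycle; every rooted triangulation has a unique minimal Schnyder wood. Corner colors: a corner at an inner vertex $v$ lies between two of its outgoing edges and gets the color of the third outgoing edge; a corner at an outer vertex gets that vertex's color. Bernardi–Bonichon map: let $T_{\mathrm{blue}}$ be the blue tree (blue edges, spanning the inner vertices and $u_B$) plus the outer edge $\{u_B,u_R\}$; let $v_0,\dots,v_n$ be the vertices of $T_{\mathrm{blue}}\setminus\{u_B\}$ ordered by first visit in a clockwise walk around $T_{\mathrm{blue}}$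 from $u_B$ (so $v_n=u_R$). Then $\gamma$ is the contour word of the blue tree without the edge $\{u_B,u_R\}$ (from $u_B$, clockwise; $N$ for each step away from the root, $E$ for each step toward it), and $\gamma'=NE^{\beta_1}NE^{\beta_2}\cdots NE^{\beta_n}$ where $\beta_r$ is the number of ingoing red edges at $v_r$. It is known that this gives a bijection between triangulations with $n+3$ vertices with their minimal Schnyder wood and $\mathcal{I}_n$. 3-mobiles: a 3-mobile is an unrooted plane tree whose vertices have degree 1 (leaves) or 3 (nodes), nodes colored black/white with adjacent nodes of different colors, all leaves adjacent to black nodes, at least one white node, and edges colored blue, green, red so that around every node the incident edges are blue, green, red in clockwise order. An edge incident to a leaf is a leg, other edges are plain. $\mathcal{T}_n$ is the set of 3-mobiles with $n$ white nodes. A black node whose blue edge is a leg has type $\binom{N}{N}$ if its red edge is also a leg, type $\binom{E}{E}$ if its green edge is also a leg, and type $\binom{E}{N}$ if its blue edge is its only leg. The 3-mobile of $M$ (with its minimal Schnyder wood): orient the outer cycle clockwise, put a black node $b_f$ in each inner face $f$; for each edge $e=u\to v$ with faces $f$ on its left and $f'$ on its right, create a plain edge $\{u,b_f\}$ if $f$ is inner (colored by the color of the corner of $f$ at $u$) and a leg at $b_{f'}$ pointing towards $v$ (colored by the color of the corner of $f'$ at $v$); then erase the outer vertices and the edges of $M$ (inner vertices become white nodes). It is known this gives a bijection onto $\mathcal{T}_n$. *)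

theory Defs
  imports Main
begin

text \<open>A simple map on vertex set V is given by a symmetric irreflexive adjacency
relation adj and a rotation system rot: for a vertex u and a neighbour w,
rot u w is the neighbour of u following w in CLOCKWISE order around u.
Darts are ordered pairs (u,w) with adj u w.  The face to the LEFT of the dart
(u,w) is traced by phi (u,w) = (w, rot w u).  The corner (u,w) at u is the angular
sector from the dart (u,w) clockwise to the dart (u, rot u w); it lies in the face
containing the dart (w,u).\<close>

datatype color = Blue | Green | Red
datatype letter = N | E
datatype lab = Out color | In color

definition darts :: "('v \<Rightarrow> 'v \<Rightarrow> bool) \<Rightarrow> ('v \<times> 'v) set" where
  "darts adj = {(u,w). adj u w}"

definition phi :: "('v \<Rightarrow> 'v \<Rightarrow> 'v) \<Rightarrow> 'v \<times> 'v \<Rightarrow> 'v \<times> 'v" where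
  "phi rot = (\<lambda>(u,w). (w, rot w u))"

definition face_of :: "('v \<Rightarrow> 'v \<Rightarrow> 'v) \<Rightarrow> 'v \<times> 'v \<Rightarrow> ('v \<times> 'v) set" where
  "face_of rot d = {(phi rot ^^ k) d | k. True}"

definition faces :: "('v \<Rightarrow> 'v \<Rightarrow> bool) \<Rightarrow> ('v \<Rightarrow> 'v \<Rightarrow> 'v) \<Rightarrow> ('v \<times> 'v) set set" where
  "faces adj rot = face_of rot ` darts adj"

definition edges :: "('v \<Rightarrow> 'v \<Rightarrow> bool) \<Rightarrow> 'v set set" where
  "edges adj = {{u,w} | u w. adj u w}"

text \<open>Simple connected map of genus 0 (Euler's formula) all of whose faces have degree 3.\<close>
definition plane_triangulation ::
  "'v set \<Rightarrow> ('v \<Rightarrow> 'v \<Rightarrow> bool) \<Rightarrow> ('v \<Rightarrow> 'v \<Rightarrow> 'v) \<Rightarrow> bool" where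
  "plane_triangulation V adj rot \<longleftrightarrow>
     finite V \<and>
     (\<forall>u w. adj u w \<longrightarrow> u \<in> V \<and> w \<in> V \<and> u \<noteq> w \<and> adj w u) \<and>
     (\<forall>u\<in>V. bij_betw (rot u) {w. adj u w} {w. adj u w} \<and>
             (\<forall>w w'. adj u w \<longrightarrow> adj u w' \<longrightarrow> (\<exists>k. (rot u ^^ k) w = w'))) \<and>
     (\<forall>u\<in>V. \<forall>w\<in>V. adj\<^sup>*\<^sup>* u w) \<and>
     card V + card (faces adj rot) = card (edges adj) + 2 \<and>
     (\<forall>d\<in>darts adj. (phi rot ^^ 3) d = d)"

text \<open>Rooted triangulation: the root corner is the corner (uB,uR) at uB; the outer face
is the face containing it, i.e. face_of rot (uR,uB) = triangle uB -> uG -> uR with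
uG = rot uB uR; uB, uG, uR are then in clockwise order along the outer face.\<close>
definition rooted_triangulation ::
  "'v set \<Rightarrow> ('v \<Rightarrow> 'v \<Rightarrow> bool) \<Rightarrow> ('v \<Rightarrow> 'v \<Rightarrow> 'v) \<Rightarrow> 'v \<Rightarrow> 'v \<Rightarrow> bool" where
  "rooted_triangulation V adj rot uB uR \<longleftrightarrow> plane_triangulation V adj rot \<and> adj uB uR"

definition outer_vs :: "('v \<Rightarrow> 'v \<Rightarrow> 'v) \<Rightarrow> 'v \<Rightarrow> 'v \<Rightarrow> 'v set" where
  "outer_vs rot uB uR = {uB, rot uB uR, uR}"

definition outer_face :: "('v \<Rightarrow> 'v \<Rightarrow> 'v) \<Rightarrow> 'v \<Rightarrow> 'v \<Rightarrow> ('v \<times> 'v) set" where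
  "outer_face rot uB uR = face_of rot (uR, uB)"

definition inner_edge ::
  "('v \<Rightarrow> 'v \<Rightarrow> bool) \<Rightarrow> ('v \<Rightarrow> 'v \<Rightarrow> 'v) \<Rightarrow> 'v \<Rightarrow> 'v \<Rightarrow> 'v \<Rightarrow> 'v \<Rightarrow> bool" where
  "inner_edge adj rot uB uR u w \<longleftrightarrow>
     adj u w \<and> \<not> (u \<in> outer_vs rot uB uR \<and> w \<in> outer_vs rot uB uR)"

definition lab :: "('v \<Rightarrow> 'v \<Rightarrow> bool) \<Rightarrow> ('v \<Rightarrow> 'v \<Rightarrow> color) \<Rightarrow> 'v \<Rightarrow> 'v \<Rightarrow> lab" where
  "lab out col v w = (if out v w then Out (col v w) else In (col v w))"

text \<open>Allowed consecutive labels in clockwise order around an inner vertex, encoding the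
cyclic pattern: out blue, in reds, out green, in blues, out red, in greens.\<close>
fun allowed_succ :: "lab \<Rightarrow> lab \<Rightarrow> bool" where
  "allowed_succ (Out Blue) l = (l = In Red \<or> l = Out Green)"
| "allowed_succ (In Red) l = (l = In Red \<or> l = Out Green)"
| "allowed_succ (Out Green) l = (l = In Blue \<or> l = Out Red)"
| "allowed_succ (In Blue) l = (l = In Blue \<or> l = Out Red)"
| "allowed_succ (Out Red) l = (l = In Green \<or> l = Out Blue)"
| "allowed_succ (In Green) l = (l = In Green \<or> l = Out Blue)"

definition schnyder_wood ::
  "'v set \<Rightarrow> ('v \<Rightarrow> 'v \<Rightarrow> bool) \<Rightarrow> ('v \<Rightarrow> 'v \<Rightarrow> 'v) \<Rightarrow> 'v \<Rightarrow> 'v \<Rightarrow>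
   ('v \<Rightarrow> 'v \<Rightarrow> bool) \<Rightarrow> ('v \<Rightarrow> 'v \<Rightarrow> color) \<Rightarrow> bool" where
  "schnyder_wood V adj rot uB uR out col \<longleftrightarrow>
     (\<forall>u w. inner_edge adj rot uB uR u w \<longrightarrow> (out u w \<longleftrightarrow> \<not> out w u) \<and> col u w = col w u) \<and>
     (\<forall>w. inner_edge adj rot uB uR w uB \<longrightarrow> out w uB \<and> col w uB = Blue) \<and>
     (\<forall>w. inner_edge adj rot uB uR w (rot uB uR) \<longrightarrow> out w (rot uB uR) \<and> col w (rot uB uR) = Green) \<and>
     (\<forall>w. inner_edge adj rot uB uR w uR \<longrightarrow> out w uR \<and> col w uR = Red) \<and>
     (\<forall>v \<in> V - outer_vs rot uB uR.
        (\<forall>c. \<exists>!w. adj v w \<and> out v w \<and> col v w = c) \<and>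
        (\<forall>w. adj v w \<longrightarrow> allowed_succ (lab out col v w) (lab out col v (rot v w))))"

definition directed_cycle ::
  "('v \<Rightarrow> 'v \<Rightarrow> bool) \<Rightarrow> ('v \<Rightarrow> 'v \<Rightarrow> 'v) \<Rightarrow> 'v \<Rightarrow> 'v \<Rightarrow> ('v \<Rightarrow> 'v \<Rightarrow> bool) \<Rightarrow> 'v list \<Rightarrow> bool" where
  "directed_cycle adj rot uB uR out cs \<longleftrightarrow>
     length cs \<ge> 3 \<and> distinct cs \<and>
     (\<forall>i < length cs. inner_edge adj rot uB uR (cs ! i) (cs ! (Suc i mod length cs)) \<and>
                      out (cs ! i) (cs ! (Suc i mod length cs)))"

definition cycle_edge :: "'v list \<Rightarrow> 'v \<Rightarrow> 'v \<Rightarrow> bool" where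
  "cycle_edge cs x y \<longleftrightarrow> (\<exists>i < length cs. {x, y} = {cs ! i, cs ! (Suc i mod length cs)})"

text \<open>Corners lying on the right side of the cycle: at cs!i, the corners swept clockwise
from the dart to the next cycle vertex up to the dart to the previous cycle vertex.\<close>
definition right_corners :: "('v \<Rightarrow> 'v \<Rightarrow> 'v) \<Rightarrow> 'v list \<Rightarrow> ('v \<times> 'v) set" where
  "right_corners rot cs =
     {(cs ! i, (rot (cs ! i) ^^ j) (cs ! (Suc i mod length cs))) | i j.
        i < length cs \<and>
        j < (LEAST m. 0 < m \<and>
               (rot (cs ! i) ^^ m) (cs ! (Suc i mod length cs)) =
               cs ! ((i + length cs - 1) mod length cs))}"

inductive_set right_region :: "('v \<Rightarrow> 'v \<Rightarrow> 'v) \<Rightarrow> 'v list \<Rightarrow> ('v \<times> 'v) set set"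
  for rot :: "'v \<Rightarrow> 'v \<Rightarrow> 'v" and cs :: "'v list" where
  corner: "(v, w) \<in> right_corners rot cs \<Longrightarrow> face_of rot (w, v) \<in> right_region rot cs"
| cross: "F \<in> right_region rot cs \<Longrightarrow> (x, y) \<in> F \<Longrightarrow> \<not> cycle_edge cs x y \<Longrightarrow>
          face_of rot (y, x) \<in> right_region rot cs"

text \<open>Clockwise: the interior (the side not containing the outer face) is on the right.\<close>
definition clockwise_cycle ::
  "('v \<Rightarrow> 'v \<Rightarrow> bool) \<Rightarrow> ('v \<Rightarrow> 'v \<Rightarrow> 'v) \<Rightarrow> 'v \<Rightarrow> 'v \<Rightarrow> ('v \<Rightarrow> 'v \<Rightarrow> bool) \<Rightarrow> 'v list \<Rightarrow> bool" where
  "clockwise_cycle adj rot uB uR out cs \<longleftrightarrow>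
     directed_cycle adj rot uB uR out cs \<and> outer_face rot uB uR \<notin> right_region rot cs"

definition minimal_schnyder_wood ::
  "'v set \<Rightarrow> ('v \<Rightarrow> 'v \<Rightarrow> bool) \<Rightarrow> ('v \<Rightarrow> 'v \<Rightarrow> 'v) \<Rightarrow> 'v \<Rightarrow> 'v \<Rightarrow>
   ('v \<Rightarrow> 'v \<Rightarrow> bool) \<Rightarrow> ('v \<Rightarrow> 'v \<Rightarrow> color) \<Rightarrow> bool" where
  "minimal_schnyder_wood V adj rot uB uR out col \<longleftrightarrow>
     schnyder_wood V adj rot uB uR out col \<and> \<not> (\<exists>cs. clockwise_cycle adj rot uB uR out cs)"

definition cw_next :: "('v \<Rightarrow> 'v \<Rightarrow> bool) \<Rightarrow> ('v \<Rightarrow> 'v \<Rightarrow> 'v) \<Rightarrow> 'v \<Rightarrow> 'v \<Rightarrow> 'v" where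
  "cw_next T rot y x = (rot y ^^ (LEAST j. 0 < j \<and> T y ((rot y ^^ j) x))) x"

text \<open>The first m darts of the clockwise contour walk of the plane tree T, starting
at uB from the root corner (uB,uR).\<close>
definition contour :: "('v \<Rightarrow> 'v \<Rightarrow> bool) \<Rightarrow> ('v \<Rightarrow> 'v \<Rightarrow> 'v) \<Rightarrow> 'v \<Rightarrow> 'v \<Rightarrow> nat \<Rightarrow> ('v \<times> 'v) list" where
  "contour T rot uB uR m =
     map (\<lambda>k. ((\<lambda>(x, y). (y, cw_next T rot y x)) ^^ k) (uB, cw_next T rot uB uR)) [0..<m]"

definition blue_tree0 ::
  "('v \<Rightarrow> 'v \<Rightarrow> bool) \<Rightarrow> ('v \<Rightarrow> 'v \<Rightarrow> 'v) \<Rightarrow> 'v \<Rightarrow> 'v \<Rightarrow> ('v \<Rightarrow> 'v \<Rightarrow> color) \<Rightarrow> 'v \<Rightarrow> 'v \<Rightarrow> bool" where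
  "blue_tree0 adj rot uB uR col x y \<longleftrightarrow> inner_edge adj rot uB uR x y \<and> col x y = Blue"

definition blue_tree ::
  "('v \<Rightarrow> 'v \<Rightarrow> bool) \<Rightarrow> ('v \<Rightarrow> 'v \<Rightarrow> 'v) \<Rightarrow> 'v \<Rightarrow> 'v \<Rightarrow> ('v \<Rightarrow> 'v \<Rightarrow> color) \<Rightarrow> 'v \<Rightarrow> 'v \<Rightarrow> bool" where
  "blue_tree adj rot uB uR col x y \<longleftrightarrow>
     blue_tree0 adj rot uB uR col x y \<or> {x, y} = {uB, uR}"

text \<open>A contour step along dart (x,y) is N iff it goes away from the root uB, i.e.
y is a child of x (blue edges are oriented towards the root).\<close>
definition step_letter ::
  "('v \<Rightarrow> 'v \<Rightarrow> bool) \<Rightarrow> ('v \<Rightarrow> 'v \<Rightarrow> 'v) \<Rightarrow> 'v \<Rightarrow> 'v \<Rightarrow> ('v \<Rightarrow> 'v \<Rightarrow> bool) \<Rightarrow> ('v \<Rightarrow> 'v \<Rightarrow> color)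
   \<Rightarrow> 'v \<times> 'v \<Rightarrow> letter" where
  "step_letter adj rot uB uR out col d =
     (if (blue_tree0 adj rot uB uR col (fst d) (snd d) \<and> out (snd d) (fst d)) \<or> d = (uB, uR)
      then N else E)"

definition bb_lower ::
  "('v \<Rightarrow> 'v \<Rightarrow> bool) \<Rightarrow> ('v \<Rightarrow> 'v \<Rightarrow> 'v) \<Rightarrow> 'v \<Rightarrow> 'v \<Rightarrow> ('v \<Rightarrow> 'v \<Rightarrow> bool) \<Rightarrow> ('v \<Rightarrow> 'v \<Rightarrow> color)
   \<Rightarrow> nat \<Rightarrow> letter list" where
  "bb_lower adj rot uB uR out col n =
     map (step_letter adj rot uB uR out col) (contour (blue_tree0 adj rot uB uR col) rot uB uR (2 * n))"

text \<open>v_0,...,v_n: vertices of T_blue other than uB, by first visit in the contour.\<close>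
definition bb_vertices ::
  "('v \<Rightarrow> 'v \<Rightarrow> bool) \<Rightarrow> ('v \<Rightarrow> 'v \<Rightarrow> 'v) \<Rightarrow> 'v \<Rightarrow> 'v \<Rightarrow> ('v \<Rightarrow> 'v \<Rightarrow> color) \<Rightarrow> nat \<Rightarrow> 'v list" where
  "bb_vertices adj rot uB uR col n =
     filter (\<lambda>v. v \<noteq> uB)
       (rev (remdups (rev (uB # map snd (contour (blue_tree adj rot uB uR col) rot uB uR (2 * (n + 1)))))))"

definition bb_upper ::
  "('v \<Rightarrow> 'v \<Rightarrow> bool) \<Rightarrow> ('v \<Rightarrow> 'v \<Rightarrow> 'v) \<Rightarrow> 'v \<Rightarrow> 'v \<Rightarrow> ('v \<Rightarrow> 'v \<Rightarrow> bool) \<Rightarrow> ('v \<Rightarrow> 'v \<Rightarrow> color)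
   \<Rightarrow> nat \<Rightarrow> letter list" where
  "bb_upper adj rot uB uR out col n =
     concat (map (\<lambda>r. N # replicate
        (card {w. inner_edge adj rot uB uR w (bb_vertices adj rot uB uR col n ! r) \<and>
                  out w (bb_vertices adj rot uB uR col n ! r) \<and>
                  col w (bb_vertices adj rot uB uR col n ! r) = Red}) E) [1..<n + 1])"

fun eruns :: "letter list \<Rightarrow> nat list" where
  "eruns [] = [0]"
| "eruns (N # w) = 0 # eruns w"
| "eruns (E # w) = (case eruns w of [] \<Rightarrow> [] | k # ks \<Rightarrow> Suc k # ks)"

definition canopy :: "letter list \<Rightarrow> letter list" where
  "canopy w = map (\<lambda>a. if a = 0 then E else N) (eruns w)"

text \<open>Type (d over c) of position r of the interval (gamma, gamma'), as the pair (d, c).\<close>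
definition position_type :: "letter list \<Rightarrow> letter list \<Rightarrow> nat \<Rightarrow> letter \<times> letter" where
  "position_type g g' r = (canopy g' ! r, canopy g ! r)"

definition ori ::
  "('v \<Rightarrow> 'v \<Rightarrow> 'v) \<Rightarrow> 'v \<Rightarrow> 'v \<Rightarrow> ('v \<Rightarrow> 'v \<Rightarrow> bool) \<Rightarrow> 'v \<Rightarrow> 'v \<Rightarrow> bool" where
  "ori rot uB uR out x y =
     (if x \<in> outer_vs rot uB uR \<and> y \<in> outer_vs rot uB uR
      then (x, y) \<in> {(uB, rot uB uR), (rot uB uR, uR), (uR, uB)} else out x y)"

definition corner_color ::
  "('v \<Rightarrow> 'v \<Rightarrow> 'v) \<Rightarrow> 'v \<Rightarrow> 'v \<Rightarrow> ('v \<Rightarrow> 'v \<Rightarrow> bool) \<Rightarrow> ('v \<Rightarrow> 'v \<Rightarrow> color) \<Rightarrow> 'v \<Rightarrow> 'v \<Rightarrow> color" where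
  "corner_color rot uB uR out col x z =
     (if x = uB then Blue else if x = rot uB uR then Green else if x = uR then Red
      else (case lab out col x z of
              Out Blue \<Rightarrow> Red | In Red \<Rightarrow> Red
            | Out Green \<Rightarrow> Blue | In Blue \<Rightarrow> Blue
            | Out Red \<Rightarrow> Green | In Green \<Rightarrow> Green))"

text \<open>Each dart (x,y) of an inner face f gives one edge of the mobile at the black node
b_f: a plain edge {x, b_f} if (x,y) is oriented x -> y (f on its left), and a leg if
it is oriented y -> x (f on its right); in both cases its colour is that of the
corner of f at x, which is the corner (x, rot y x).\<close>
definition mobile_color ::
  "('v \<Rightarrow> 'v \<Rightarrow> 'v) \<Rightarrow> 'v \<Rightarrow> 'v \<Rightarrow> ('v \<Rightarrow> 'v \<Rightarrow> bool) \<Rightarrow> ('v \<Rightarrow> 'v \<Rightarrow> color) \<Rightarrow> 'v \<times> 'v \<Rightarrow> color" where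
  "mobile_color rot uB uR out col d = corner_color rot uB uR out col (fst d) (rot (snd d) (fst d))"

definition is_leg :: "('v \<Rightarrow> 'v \<Rightarrow> 'v) \<Rightarrow> 'v \<Rightarrow> 'v \<Rightarrow> ('v \<Rightarrow> 'v \<Rightarrow> bool) \<Rightarrow> 'v \<times> 'v \<Rightarrow> bool" where
  "is_leg rot uB uR out d = ori rot uB uR out (snd d) (fst d)"

definition inner_faces :: "('v \<Rightarrow> 'v \<Rightarrow> bool) \<Rightarrow> ('v \<Rightarrow> 'v \<Rightarrow> 'v) \<Rightarrow> 'v \<Rightarrow> 'v \<Rightarrow> ('v \<times> 'v) set set" where
  "inner_faces adj rot uB uR = faces adj rot - {outer_face rot uB uR}"

definition leg_of_color ::
  "('v \<Rightarrow> 'v \<Rightarrow> 'v) \<Rightarrow> 'v \<Rightarrow> 'v \<Rightarrow> ('v \<Rightarrow> 'v \<Rightarrow> bool) \<Rightarrow> ('v \<Rightarrow> 'v \<Rightarrow> color) \<Rightarrow> ('v \<times> 'v) set \<Rightarrow> color \<Rightarrow> bool" where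
  "leg_of_color rot uB uR out col f c \<longleftrightarrow>
     (\<exists>d\<in>f. mobile_color rot uB uR out col d = c \<and> is_leg rot uB uR out d)"

definition blue_leg_nodes ::
  "('v \<Rightarrow> 'v \<Rightarrow> bool) \<Rightarrow> ('v \<Rightarrow> 'v \<Rightarrow> 'v) \<Rightarrow> 'v \<Rightarrow> 'v \<Rightarrow> ('v \<Rightarrow> 'v \<Rightarrow> bool) \<Rightarrow> ('v \<Rightarrow> 'v \<Rightarrow> color)
   \<Rightarrow> ('v \<times> 'v) set set" where
  "blue_leg_nodes adj rot uB uR out col =
     {f \<in> inner_faces adj rot uB uR. leg_of_color rot uB uR out col f Blue}"

definition node_has_type ::
  "('v \<Rightarrow> 'v \<Rightarrow> 'v) \<Rightarrow> 'v \<Rightarrow> 'v \<Rightarrow> ('v \<Rightarrow> 'v \<Rightarrow> bool) \<Rightarrow> ('v \<Rightarrow> 'v \<Rightarrow> color)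
   \<Rightarrow> ('v \<times> 'v) set \<Rightarrow> letter \<times> letter \<Rightarrow> bool" where
  "node_has_type rot uB uR out col f t \<longleftrightarrow>
     leg_of_color rot uB uR out col f Blue \<and>
     ((t = (N, N) \<and> leg_of_color rot uB uR out col f Red) \<or>
      (t = (E, E) \<and> leg_of_color rot uB uR out col f Green) \<or>
      (t = (E, N) \<and> \<not> leg_of_color rot uB uR out col f Red \<and>
                     \<not> leg_of_color rot uB uR out col f Green))"

end

theory Submission
  imports Defs
begin

text \<open>A black node whose blue edge is a leg is a face to the left of a dart from a vertex \<open>x\<close> to a
  child \<open>v\<close> in the blue tree (including the edge from \<open>uB\<close> to \<open>uR\<close>), so these nodes correspond to
  \<open>v\<^sub>0, \<dots>, v\<^sub>n\<close>. Let \<open>z\<close> be the third vertex of the face. Its red edge is a leg iff \<open>v\<close> has an ingoing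
  red edge, that is, iff the upper canopy has letter \<open>N\<close>; its green edge is a leg iff the edge before
  \<open>v\<close> around \<open>x\<close> is not a blue child of \<open>x\<close>, that is, iff \<open>v\<close> is a first child, that is, iff
  the lower canopy has letter \<open>E\<close>. Both at once would make the face a clockwise directed cycle. (For
  the first position the upper letter is always \<open>E\<close>, and \<open>v\<^sub>0\<close> is a first child.)

  That the contour visits every vertex needs the blue edges to be acyclic. A monochromatic directed
  cycle has, on the side away from the outer face, one outgoing edge of some other color at each of
  its vertices, and no ingoing edge of that color; following that color inwards gives a
  monochromatic cycle around fewer faces.\<close>

text \<open>Planarity is given only as Euler's formula for a rotation system, so a side of a cycle
  has no geometric meaning. It is represented by a set of faces that can be left only across cycle
  edges; a counting argument produces such a set without telling whether it lies on the left or on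
  the right. At a cycle vertex the outgoing edge of the next color lies on the right and the ingoing
  edges of that color on the left, and conversely for the previous color. So either side has a color
  to follow, and the descent has to change color.

  The contour is given as the orbit of a map on darts, which offers no induction. A plane tree is
  therefore built by recursion along the child relation, and its recursively defined tour is shown
  to be that orbit. Two contours are needed, without and with the edge from \<open>uB\<close> to
  \<open>uR\<close>; one tree serves both, and \<open>uR\<close>, appended at the end, accounts for
  the last position.\<close>

section \<open>Spanning-tree counts and cyclic enumeration\<close>

text \<open>A spanning tree grown one cut edge at a time: the crossing edge is new because every
  edge collected so far has both ends in \<open>S\<close>. The incidence \<open>J\<close> is
  abstract since the bound is applied to vertices with edges and also to faces with dual
  edges.\<close>

lemma card_le_Suc_edges:
  fixes J :: "'e \<Rightarrow> 'x \<Rightarrow> 'x \<Rightarrow> bool"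
  assumes fin: "finite X" "finite Es"
    and ends: "\<And>e x y x' y'. J e x y \<Longrightarrow> J e x' y' \<Longrightarrow> {x, y} = {x', y'}"
    and conn: "\<And>S. S \<subset> X \<Longrightarrow> S \<noteq> {} \<Longrightarrow> \<exists>e\<in>Es. \<exists>x\<in>S. \<exists>y\<in>X - S. J e x y"
  shows "card X \<le> card Es + 1"
proof (cases "X = {}")
  case False
  have grow: "\<exists>S Q. S \<subseteq> X \<and> card S = Suc k \<and> Q \<subseteq> Es \<and> card Q = k \<and>
      (\<forall>e\<in>Q. \<forall>x y. J e x y \<longrightarrow> x \<in> S \<and> y \<in> S)" if "Suc k \<le> card X" for k
    using that
  proof (induction k)
    case 0
    obtain x where "x \<in> X" using False by blast
    then have "{x} \<subseteq> X \<and> card {x} = Suc 0 \<and> {} \<subseteq> Es \<and> card ({} :: 'e set) = 0" by simp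
    then show ?case by blast
  next
    case (Suc k)
    then obtain S Q where SQ: "S \<subseteq> X" "card S = Suc k" "Q \<subseteq> Es" "card Q = k"
      "\<forall>e\<in>Q. \<forall>x y. J e x y \<longrightarrow> x \<in> S \<and> y \<in> S" by auto
    have "S \<noteq> X" "S \<noteq> {}" using SQ(2) Suc.prems by (metis Suc_n_not_le_n, metis card.empty nat.distinct(1))
    then have "S \<subset> X" "S \<noteq> {}" using SQ(1) by blast+
    from conn[OF this] obtain e x y where e: "e \<in> Es" "x \<in> S" "y \<in> X - S" "J e x y"
      by blast
    have "e \<notin> Q" using SQ(5) e by blast
    moreover have "finite S" "finite Q" using fin SQ finite_subset by blast+
    moreover have "x' \<in> insert y S \<and> y' \<in> insert y S" if "J e x' y'" for x' y'
      using ends[OF e(4) that] e(2) by (auto simp: doubleton_eq_iff)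
    ultimately show ?case
      using SQ e by (intro exI[of _ "insert y S"] exI[of _ "insert e Q"]) auto
  qed
  have "card X > 0" using False fin by (simp add: card_gt_0_iff)
  then obtain k where k: "card X = Suc k" by (cases "card X") auto
  then obtain Q where "Q \<subseteq> Es" "card Q = k" using grow[of k] by auto
  then have "k \<le> card Es" using fin(2) card_mono by blast
  then show ?thesis using k by simp
qed simp

text \<open>\<open>d\<close> is the least period of \<open>a\<close>. Applied to
  \<open>rot v\<close>, this lists the neighbours of \<open>v\<close> clockwise from a chosen
  one.\<close>

lemma cyclic_enumeration:
  assumes bij: "bij_betw f A A" and a: "a \<in> A"
    and trans: "\<And>x y. x \<in> A \<Longrightarrow> y \<in> A \<Longrightarrow> \<exists>k. (f ^^ k) x = y"
  obtains d where "d > 0" "(f ^^ d) a = a" "inj_on (\<lambda>j. (f ^^ j) a) {..<d}"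
    "(\<lambda>j. (f ^^ j) a) ` {..<d} = A"
proof -
  have fA: "f x \<in> A" if "x \<in> A" for x using bij that by (auto simp: bij_betw_def)
  have iterA: "(f ^^ k) x \<in> A" if "x \<in> A" for k x using that by (induction k) (auto intro: fA)
  have inj: "x = y" if "x \<in> A" "y \<in> A" "(f ^^ k) x = (f ^^ k) y" for k x y
    using that
  proof (induction k)
    case (Suc k)
    then have "(f ^^ k) x = (f ^^ k) y"
      using bij iterA by (auto simp: bij_betw_def inj_on_def)
    then show ?case using Suc by blast
  qed simp
  define P where "P d \<longleftrightarrow> d > 0 \<and> (f ^^ d) a = a" for d
  obtain k where "(f ^^ k) (f a) = a" using trans[OF fA[OF a] a] by blast
  then have "P (Suc k)" unfolding P_def by (simp add: funpow_swap1)
  then have Pd: "P (LEAST d. P d)" by (rule LeastI)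
  define d where "d = (LEAST d. P d)"
  have d: "d > 0" "(f ^^ d) a = a" using Pd unfolding d_def P_def by auto
  have "inj_on (\<lambda>j. (f ^^ j) a) {..<d}"
  proof (rule linorder_inj_onI)
    fix i j assume ij: "i < j" "i \<in> {..<d}" "j \<in> {..<d}"
    show "(f ^^ i) a \<noteq> (f ^^ j) a"
    proof
      assume eq: "(f ^^ i) a = (f ^^ j) a"
      have "(f ^^ j) a = (f ^^ i) ((f ^^ (j - i)) a)"
        using ij(1) by (metis add_diff_inverse_nat funpow_add less_imp_le_nat not_less o_apply)
      then have "a = (f ^^ (j - i)) a" using inj[OF a iterA[OF a]] eq by simp
      then have "P (j - i)" using ij unfolding P_def by auto
      then have "d \<le> j - i" unfolding d_def by (rule Least_le)
      then show False using ij by auto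
    qed
  qed auto
  moreover have "(\<lambda>j. (f ^^ j) a) ` {..<d} = A"
  proof
    show "A \<subseteq> (\<lambda>j. (f ^^ j) a) ` {..<d}"
    proof
      fix x assume "x \<in> A"
      then obtain k where "(f ^^ k) a = x" using trans a by blast
      then have "(f ^^ (k mod d)) a = x" using d by (simp add: funpow_mod_eq)
      then show "x \<in> (\<lambda>j. (f ^^ j) a) ` {..<d}" using d by (intro image_eqI[of _ _ "k mod d"]) auto
    qed
  qed (use iterA[OF a] in auto)
  ultimately show ?thesis using d that by blast
qed

section \<open>Triangulations as rotation systems\<close>

locale triangulation =
  fixes V :: "'v set" and adj :: "'v \<Rightarrow> 'v \<Rightarrow> bool" and rot :: "'v \<Rightarrow> 'v \<Rightarrow> 'v"
  assumes plane: "plane_triangulation V adj rot"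
begin

abbreviation fc :: "'v \<Rightarrow> 'v \<Rightarrow> ('v \<times> 'v) set" where
  "fc u w \<equiv> face_of rot (u, w)"

abbreviation Fs :: "('v \<times> 'v) set set" where
  "Fs \<equiv> faces adj rot"

lemma finite_V: "finite V"
  using plane by (simp add: plane_triangulation_def)

lemma adjD:
  assumes "adj u w"
  shows "u \<in> V" "w \<in> V" "u \<noteq> w" "adj w u"
  using plane assms unfolding plane_triangulation_def by blast+

lemma bij_rot: "u \<in> V \<Longrightarrow> bij_betw (rot u) {w. adj u w} {w. adj u w}"
  using plane unfolding plane_triangulation_def by blast

lemma rot_cyclic: "adj u w \<Longrightarrow> adj u w' \<Longrightarrow> \<exists>k. (rot u ^^ k) w = w'"
  using plane adjD(1)[of u w] unfolding plane_triangulation_def by blast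

lemma adj_rot: "adj u w \<Longrightarrow> adj u (rot u w)"
  using bij_rot[of u] adjD(1)[of u w] by (auto simp: bij_betw_def)

lemma adj_funpow_rot: "adj u w \<Longrightarrow> adj u ((rot u ^^ k) w)"
  by (induction k) (auto intro: adj_rot)

lemma rot_inj: "adj u w \<Longrightarrow> adj u w' \<Longrightarrow> rot u w = rot u w' \<Longrightarrow> w = w'"
  using bij_rot[of u] adjD(1)[of u w] by (auto simp: bij_betw_def inj_on_def)

lemma V_connected: "u \<in> V \<Longrightarrow> w \<in> V \<Longrightarrow> adj\<^sup>*\<^sup>* u w"
  using plane unfolding plane_triangulation_def by blast

lemma euler: "card V + card Fs = card (edges adj) + 2"
  using plane unfolding plane_triangulation_def by blast

lemma triangle:
  assumes "adj u w"
  defines "z \<equiv> rot w u"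
  shows "adj w z" "adj z w" "adj z u" "adj u z" "rot z w = u" "rot u z = w" "z \<noteq> u" "z \<noteq> w"
proof -
  have "(phi rot ^^ 3) (u, w) = (u, w)"
    using plane assms(1) unfolding plane_triangulation_def darts_def by blast
  then have r: "rot z w = u" "rot u z = w"
    by (auto simp: phi_def numeral_3_eq_3 z_def)
  show 1: "adj w z" "adj z w" using adj_rot[of w u] adjD assms(1) unfolding z_def by blast+
  then show 2: "adj z u" "adj u z" using adj_rot[of z w] r adjD by metis+
  show "z \<noteq> u" "z \<noteq> w" using 1 2 adjD by blast+
  show "rot z w = u" "rot u z = w" by fact+
qed

lemma fc_eq:
  assumes "adj u w"
  shows "fc u w = {(u, w), (w, rot w u), (rot w u, u)}"
proof -
  have t: "rot (rot w u) w = u" "rot u (rot w u) = w" using triangle assms by auto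
  have "(phi rot ^^ (3 * k + i)) (u, w) = (phi rot ^^ i) (u, w)" for k i
  proof (induction k)
    case (Suc k)
    have "3 * Suc k + i = 3 * k + i + 3" by simp
    then have "(phi rot ^^ (3 * Suc k + i)) (u, w) = (phi rot ^^ (3 * k + i)) ((phi rot ^^ 3) (u, w))"
      by (simp only: funpow_add o_apply)
    also have "(phi rot ^^ 3) (u, w) = (u, w)"
      using t by (simp add: phi_def numeral_3_eq_3)
    finally show ?case using Suc by simp
  qed simp
  then have per: "(phi rot ^^ k) (u, w) = (phi rot ^^ (k mod 3)) (u, w)" for k
    by (metis mult_div_mod_eq)
  have "(phi rot ^^ k) (u, w) \<in> {(u, w), (w, rot w u), (rot w u, u)}" for k
  proof -
    have "k mod 3 = 0 \<or> k mod 3 = 1 \<or> k mod 3 = 2" by auto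
    then show ?thesis
      using per[of k] t by (auto simp: phi_def numeral_2_eq_2)
  qed
  moreover have "(phi rot ^^ 0) (u, w) = (u, w)" "(phi rot ^^ 1) (u, w) = (w, rot w u)"
    "(phi rot ^^ 2) (u, w) = (rot w u, u)" using t by (auto simp: phi_def numeral_2_eq_2)
  ultimately have "(u, w) \<in> face_of rot (u, w)" "(w, rot w u) \<in> face_of rot (u, w)"
    "(rot w u, u) \<in> face_of rot (u, w)" "face_of rot (u, w) \<subseteq> {(u, w), (w, rot w u), (rot w u, u)}"
    unfolding face_of_def by (metis (mono_tags, lifting) mem_Collect_eq, metis (mono_tags, lifting) mem_Collect_eq,
      metis (mono_tags, lifting) mem_Collect_eq, blast)
  then show ?thesis by blast
qed

text \<open>Read at \<open>w\<close>: the face left of an ingoing dart is also left of the next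
  outgoing dart clockwise. Turning around a vertex means alternating this equation with crossing an
  edge.\<close>

lemma fc_step:
  assumes "adj u w"
  shows "fc w (rot w u) = fc u w"
  using fc_eq[OF assms] fc_eq[OF triangle(1)[OF assms]] triangle[OF assms] by auto

lemma fc_mem: "adj u w \<Longrightarrow> (u, w) \<in> fc u w"
  by (simp add: fc_eq)

lemma fc_memD:
  assumes "adj u w" "(x, y) \<in> fc u w"
  shows "adj x y" "fc x y = fc u w"
proof -
  note t = triangle[OF assms(1)]
  consider "x = u \<and> y = w" | "x = w \<and> y = rot w u" | "x = rot w u \<and> y = u"
    using assms by (auto simp: fc_eq)
  then have "adj x y \<and> fc x y = fc u w"
    using assms(1) t fc_step[OF assms(1)] fc_step[OF t(1)] by cases auto
  then show "adj x y" "fc x y = fc u w" by auto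
qed

lemma fc_in_Fs: "adj u w \<Longrightarrow> fc u w \<in> Fs"
  by (auto simp: faces_def darts_def)

lemma FsE: assumes "f \<in> Fs" obtains u w where "adj u w" "f = fc u w"
  using assms by (auto simp: faces_def darts_def)

lemma finite_darts: "finite (darts adj)"
  by (rule finite_subset[of _ "V \<times> V"]) (auto simp: darts_def finite_V dest: adjD)

lemma finite_Fs: "finite Fs"
  by (simp add: faces_def finite_darts)

lemma finite_edges: "finite (edges adj)"
proof -
  have "edges adj = (\<lambda>(u, w). {u, w}) ` darts adj" by (auto simp: edges_def darts_def)
  then show ?thesis by (simp add: finite_darts)
qed

lemma nbr_enumeration:
  assumes "adj v a"
  obtains d where "d > 0" "(rot v ^^ d) a = a" "inj_on (\<lambda>j. (rot v ^^ j) a) {..<d}"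
    "(\<lambda>j. (rot v ^^ j) a) ` {..<d} = {w. adj v w}"
proof (rule cyclic_enumeration[of "rot v" "{w. adj v w}" a])
  show "bij_betw (rot v) {w. adj v w} {w. adj v w}" using bij_rot adjD assms by blast
  show "a \<in> {w. adj v w}" using assms by simp
  show "\<exists>k. (rot v ^^ k) x = y" if "x \<in> {w. adj v w}" "y \<in> {w. adj v w}" for x y
    using rot_cyclic that by blast
qed (rule that)

section \<open>Dual connectivity, cuts and the discrete Jordan curve theorem\<close>

text \<open>A set of faces closed under crossing edges contains, with one face at a vertex, all
  faces at that vertex; connectivity of the graph then carries it from vertex to vertex.\<close>

lemma dual_connected:
  assumes A: "A \<subset> Fs" "A \<noteq> {}"
  shows "\<exists>u w. adj u w \<and> fc u w \<in> A \<and> fc w u \<notin> A"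
proof (rule ccontr)
  assume "\<not> ?thesis"
  then have flip: "\<And>u w. adj u w \<Longrightarrow> fc u w \<in> A \<Longrightarrow> fc w u \<in> A" by blast
  have around: "fc v w' \<in> A" if "fc v w \<in> A" "adj v w" "adj v w'" for v w w'
  proof -
    have "fc v ((rot v ^^ k) w) \<in> A" for k
    proof (induction k)
      case (Suc k)
      let ?x = "(rot v ^^ k) w"
      have a: "adj v ?x" using that adj_funpow_rot by blast
      then have "fc ?x v \<in> A" using flip Suc by blast
      then show ?case using fc_step[of ?x v] adjD[OF a] by simp
    qed (use that in simp)
    then show ?thesis using rot_cyclic[OF that(2,3)] by metis
  qed
  obtain u w where uw: "adj u w" "fc u w \<in> A" using A by (metis FsE equals0I psubsetD)
  have "\<forall>w'. adj x w' \<longrightarrow> fc x w' \<in> A" if "adj\<^sup>*\<^sup>* u x" for x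
    using that
  proof (induction rule: rtranclp_induct)
    case base
    then show ?case using around uw by blast
  next
    case (step y z)
    then have "fc z y \<in> A" using flip by blast
    then show ?case using around adjD(4)[OF step(2)] by blast
  qed
  then have "Fs \<subseteq> A" using V_connected adjD(1) uw(1) by (metis FsE subsetI)
  then show False using A by blast
qed

text \<open>A vertex cut is a coboundary, so it pairs to zero with the boundary of any set of faces.\<close>

lemma cut_pairing:
  fixes S :: "'v set" and A :: "('v \<times> 'v) set set"
  defines "D \<equiv> {(u, w). adj u w \<and> fc u w \<in> A}"
  shows "(\<Sum>d\<in>D. of_bool (fst d \<in> S) - of_bool (snd d \<in> S) :: int) = 0"
proof -
  have fin: "finite D"
    unfolding D_def by (rule finite_subset[OF _ finite_darts]) (auto simp: darts_def)
  have maps: "phi rot ` D \<subseteq> D"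
    using triangle fc_step unfolding D_def phi_def by auto
  have "inj_on (phi rot) D"
  proof (rule inj_onI)
    fix d d' assume d: "d \<in> D" "d' \<in> D" "phi rot d = phi rot d'"
    then have "(phi rot ^^ 3) d = (phi rot ^^ 3) d'"
      by (simp add: numeral_3_eq_3)
    moreover have "(phi rot ^^ 3) e = e" if "e \<in> D" for e
      using plane that unfolding plane_triangulation_def darts_def D_def by blast
    ultimately show "d = d'" using d by simp
  qed
  then have "bij_betw (phi rot) D D"
    using maps fin by (simp add: bij_betw_def endo_inj_surj)
  \<comment> \<open>The head of a dart is the tail of its successor in the face, and
    \<open>phi rot\<close> permutes \<open>D\<close>; so heads and tails give the same sum.\<close>
  then have "(\<Sum>d\<in>D. of_bool (fst (phi rot d) \<in> S) :: int) = (\<Sum>d\<in>D. of_bool (fst d \<in> S))"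
    by (rule sum.reindex_bij_betw)
  moreover have "fst (phi rot d) = snd d" for d by (auto simp: phi_def split: prod.splits)
  ultimately show ?thesis by (simp add: sum_subtractf)
qed

text \<open>Discrete Jordan curve theorem; the last assumption says in terms of vertex cuts that
  \<open>e0\<close> lies on a cycle of edges of \<open>K\<close>. If the dual edges off \<open>K\<close> connected all faces, a minimal
  connecting set \<open>D\<close> of them would leave, by Euler's formula, too few edges to connect the vertices
  without \<open>e0\<close>. The resulting vertex cut lies in \<open>D\<close>, every edge of which is a dual bridge,
  against \<open>cut_pairing\<close>.\<close>

lemma jordan:
  assumes K: "K \<subseteq> edges adj" "e0 \<in> K"
    and cyc: "\<And>S u w. S \<subseteq> V \<Longrightarrow> e0 = {u, w} \<Longrightarrow> u \<in> S \<Longrightarrow> w \<notin> S \<Longrightarrow>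
       \<exists>u' w'. {u', w'} \<in> K \<and> {u', w'} \<noteq> e0 \<and> u' \<in> S \<and> w' \<notin> S"
  shows "\<exists>A. A \<noteq> {} \<and> A \<subset> Fs \<and>
     (\<forall>u w. adj u w \<longrightarrow> fc u w \<in> A \<longrightarrow> fc w u \<notin> A \<longrightarrow> {u, w} \<in> K)"
proof (rule ccontr)
  assume neg: "\<not> ?thesis"
  define conn where "conn D \<longleftrightarrow> D \<subseteq> edges adj - K \<and>
    (\<forall>A. A \<noteq> {} \<longrightarrow> A \<subset> Fs \<longrightarrow> (\<exists>u w. adj u w \<and> fc u w \<in> A \<and> fc w u \<notin> A \<and> {u, w} \<in> D))" for D
  have "conn (edges adj - K)"
    unfolding conn_def
  proof (intro conjI allI impI)
    fix A :: "('v \<times> 'v) set set" assume "A \<noteq> {}" "A \<subset> Fs"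
    then obtain u w where "adj u w" "fc u w \<in> A" "fc w u \<notin> A" "{u, w} \<notin> K"
      using neg by blast
    moreover from this have "{u, w} \<in> edges adj" by (auto simp: edges_def)
    ultimately show "\<exists>u w. adj u w \<and> fc u w \<in> A \<and> fc w u \<notin> A \<and> {u, w} \<in> edges adj - K"
      by blast
  qed simp
  then obtain D where D: "conn D" and Dmin: "\<And>D'. conn D' \<Longrightarrow> card D \<le> card D'"
    using ex_has_least_nat[of conn _ card] by blast
  have DE: "D \<subseteq> edges adj - K" using D conn_def by blast
  have finD: "finite D" using DE finite_edges finite_subset by blast
  have edge_of: "adj u w" if "{u, w} \<in> edges adj" for u w
    using that adjD unfolding edges_def by (auto simp: doubleton_eq_iff)
  have cF: "card Fs \<le> card D + 1"
  proof (rule card_le_Suc_edges[where J = "\<lambda>e f g. \<exists>u w. e = {u, w} \<and> f = fc u w \<and> g = fc w u"])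
    show "\<exists>e\<in>D. \<exists>x\<in>S. \<exists>y\<in>Fs - S. \<exists>u w. e = {u, w} \<and> x = fc u w \<and> y = fc w u"
      if S: "S \<subset> Fs" "S \<noteq> {}" for S
    proof -
      obtain u w where "adj u w" "fc u w \<in> S" "fc w u \<notin> S" "{u, w} \<in> D"
        using D S unfolding conn_def by blast
      then show ?thesis using fc_in_Fs[of w u] adjD(4)[of u w] by blast
    qed
  qed (use finite_Fs finD in \<open>auto simp: doubleton_eq_iff\<close>)
  define Q where "Q = edges adj - D - {e0}"
  have "e0 \<notin> D" "e0 \<in> edges adj" using DE K by auto
  then have cQ: "card Q + 1 + card D = card (edges adj)"
  proof -
    have "card (edges adj - D) = card (edges adj) - card D" "card D \<le> card (edges adj)"
      using DE finD finite_edges by (auto intro!: card_Diff_subset card_mono)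
    moreover have "Suc (card Q) = card (edges adj - D)"
      unfolding Q_def using \<open>e0 \<notin> D\<close> \<open>e0 \<in> edges adj\<close> finite_edges by (intro card_Suc_Diff1) auto
    ultimately show ?thesis by simp
  qed
  \<comment> \<open>By Euler's formula \<open>card V = card (edges adj) + 2 - card Fs\<close>, which
    by \<open>cF\<close> and \<open>cQ\<close> is at least \<open>card Q + 2\<close>.\<close>
  have nc: "\<not> card V \<le> card Q + 1" using euler cQ cF by linarith
  have finQ: "finite Q" unfolding Q_def using finite_edges by simp
  have "\<not> (\<forall>S. S \<subset> V \<longrightarrow> S \<noteq> {} \<longrightarrow> (\<exists>e\<in>Q. \<exists>x\<in>S. \<exists>y\<in>V - S. e = {x, y}))"
  proof
    assume *: "\<forall>S. S \<subset> V \<longrightarrow> S \<noteq> {} \<longrightarrow> (\<exists>e\<in>Q. \<exists>x\<in>S. \<exists>y\<in>V - S. e = {x, y})"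
    have "card V \<le> card Q + 1"
      by (rule card_le_Suc_edges[OF finite_V finQ, where J = "\<lambda>e x y. e = {x, y}"])
        (simp, use * in blast)
    then show False using nc by blast
  qed
  then obtain S where S: "S \<subset> V" "S \<noteq> {}" and nS': "\<not> (\<exists>e\<in>Q. \<exists>x\<in>S. \<exists>y\<in>V - S. e = {x, y})"
    by meson
  have nS: "False" if "{x, y} \<in> Q" "x \<in> S" "y \<in> V - S" for x y
    using nS' that by metis
  \<comment> \<open>An edge leaving \<open>S\<close> is not in \<open>Q\<close>, so outside
    \<open>D\<close> it could only be \<open>e0\<close>. But then another edge of \<open>K\<close>
    would leave \<open>S\<close>, and that one does lie in \<open>Q\<close>.\<close>
  have cut: "{u, w} \<in> D" if uw: "adj u w" "u \<in> S" "w \<notin> S" for u w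
  proof (rule ccontr)
    assume nD: "{u, w} \<notin> D"
    have "{u, w} \<in> edges adj" using uw by (auto simp: edges_def)
    then have "{u, w} = e0" using nS[of u w] uw adjD[of u w] nD unfolding Q_def by auto
    then obtain u' w' where k: "{u', w'} \<in> K" "{u', w'} \<noteq> e0" "u' \<in> S" "w' \<notin> S"
      using cyc[of S u w] S uw by auto
    then have "{u', w'} \<in> Q" using DE K unfolding Q_def by auto
    moreover have "w' \<in> V" using edge_of[of u' w'] k K adjD by blast
    ultimately show False using nS k by blast
  qed
  obtain x y where xy: "x \<in> S" "y \<in> V - S" using S by blast
  have "\<exists>a b. adj a b \<and> a \<in> S \<and> b \<notin> S"
  proof (rule ccontr)
    assume *: "\<not> ?thesis"
    have "adj\<^sup>*\<^sup>* x y" using V_connected xy S by blast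
    then have "y \<in> S" by (induction rule: rtranclp_induct) (use xy * in blast)+
    then show False using xy by blast
  qed
  then obtain a b where ab: "adj a b" "a \<in> S" "b \<notin> S" by blast
  have e: "{a, b} \<in> D" using cut ab by blast
  have "\<not> conn (D - {{a, b}})"
  proof
    assume "conn (D - {{a, b}})"
    then have "card D \<le> card (D - {{a, b}})" by (rule Dmin)
    then show False using e finD by (metis card_Diff1_less not_less)
  qed
  \<comment> \<open>By minimality of \<open>D\<close> some set \<open>A\<close> of faces is cut off
    once \<open>{a, b}\<close> is removed: \<open>{a, b}\<close> is the only edge of
    \<open>D\<close> leading out of \<open>A\<close>.\<close>
  then obtain A where A: "A \<noteq> {}" "A \<subset> Fs"
    and nA: "\<And>u w. adj u w \<Longrightarrow> fc u w \<in> A \<Longrightarrow> fc w u \<notin> A \<Longrightarrow> {u, w} \<in> D \<Longrightarrow> {u, w} = {a, b}"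
  proof -
    have "D - {{a, b}} \<subseteq> edges adj - K" using DE by blast
    then obtain A where A: "A \<noteq> {}" "A \<subset> Fs"
      and n: "\<not> (\<exists>u w. adj u w \<and> fc u w \<in> A \<and> fc w u \<notin> A \<and> {u, w} \<in> D - {{a, b}})"
      using \<open>\<not> conn (D - {{a, b}})\<close> unfolding conn_def by meson
    show thesis by (rule that[OF A]) (use n in blast)
  qed
  then obtain u0 w0 where u0: "adj u0 w0" "fc u0 w0 \<in> A" "fc w0 u0 \<notin> A" "{u0, w0} \<in> D"
    using D unfolding conn_def by blast
  have e0: "{u0, w0} = {a, b}" using nA u0 by blast
  define \<chi> :: "'v \<times> 'v \<Rightarrow> int" where "\<chi> d = of_bool (fst d \<in> S) - of_bool (snd d \<in> S)" for d
  let ?D = "{(u, w). adj u w \<and> fc u w \<in> A}"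
  let ?B = "{(u, w). adj u w \<and> fc u w \<in> A \<and> fc w u \<in> A}"
  let ?C = "{(u, w). adj u w \<and> fc u w \<in> A \<and> fc w u \<notin> A}"
  have finB: "finite ?B" and finC: "finite ?C"
    by (rule finite_subset[OF _ finite_darts], force simp: darts_def)+
  have "0 = sum \<chi> ?D" using cut_pairing[where A = A and S = S] unfolding \<chi>_def by simp
  also have "?D = ?B \<union> ?C" by auto
  also have "sum \<chi> (?B \<union> ?C) = sum \<chi> ?B + sum \<chi> ?C"
    by (rule sum.union_disjoint) (use finB finC in auto)
  also have "sum \<chi> ?B = 0"
  proof -
    have "sum \<chi> ?B = sum (\<lambda>d. \<chi> (prod.swap d)) ?B"
      by (rule sum.reindex_bij_witness[of _ prod.swap prod.swap]) (auto dest: adjD)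
    also have "\<dots> = - sum \<chi> ?B"
      unfolding sum_negf[symmetric] by (rule sum.cong) (auto simp: \<chi>_def)
    finally show ?thesis by simp
  qed
  \<comment> \<open>A dart out of \<open>A\<close> with nonzero \<open>\<chi>\<close> crosses the
    vertex cut, so its edge lies in \<open>D\<close> and is the bridge \<open>{a, b}\<close>. This
    single dart contributes 1 or -1, so the total cannot vanish.\<close>
  also have "sum \<chi> ?C = sum \<chi> {(u0, w0)}"
  proof (rule sum.mono_neutral_right)
    show "\<forall>i\<in>?C - {(u0, w0)}. \<chi> i = 0"
    proof
      fix d assume "d \<in> ?C - {(u0, w0)}"
      then obtain u w where uw: "adj u w" "fc u w \<in> A" "fc w u \<notin> A" "(u, w) \<noteq> (u0, w0)" "d = (u, w)"
        by blast
      have "\<chi> (u, w) = 0"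
      proof (rule ccontr)
        assume "\<chi> (u, w) \<noteq> 0"
        then have "u \<in> S \<longleftrightarrow> w \<notin> S" by (auto simp: \<chi>_def)
        then have "{u, w} \<in> D" using cut[of u w] cut[of w u] uw adjD(4)
          by (auto simp: insert_commute)
        then have "{u, w} = {u0, w0}" using nA uw e0 by blast
        then show False using uw u0 by (auto simp: doubleton_eq_iff)
      qed
      then show "\<chi> d = 0" using uw by simp
    qed
  qed (use u0 finC in auto)
  finally have "sum \<chi> {(u0, w0)} = 0" by simp
  then show False using e0 ab by (auto simp: \<chi>_def doubleton_eq_iff)
qed

end

section \<open>Labels in clockwise order around an inner vertex\<close>

fun nxt :: "color \<Rightarrow> color" where
  "nxt Blue = Green" | "nxt Green = Red" | "nxt Red = Blue"

fun prv :: "color \<Rightarrow> color" where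
  "prv Blue = Red" | "prv Green = Blue" | "prv Red = Green"

text \<open>Clockwise order of the labels around an inner vertex, starting from the outgoing edge of
  color \<open>c\<close>.\<close>

definition rank :: "color \<Rightarrow> lab \<Rightarrow> nat" where
  "rank c l = (case l of
     Out c' \<Rightarrow> if c' = c then 0 else if c' = nxt c then 2 else 4
   | In c' \<Rightarrow> if c' = c then 3 else if c' = nxt c then 5 else 1)"

lemma rank_simps [simp]:
  "rank c (Out c) = 0" "rank c (In (prv c)) = 1" "rank c (Out (nxt c)) = 2"
  "rank c (In c) = 3" "rank c (Out (prv c)) = 4" "rank c (In (nxt c)) = 5"
  by (cases c; simp add: rank_def)+

text \<open>Read from \<open>Out c\<close> on, the cyclic pattern runs through the ranks in
  increasing order, so a drop can only be the return to \<open>Out c\<close>.\<close>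

lemma allowed_succ_rank: "allowed_succ l l' \<Longrightarrow> rank c l \<le> rank c l' \<or> l' = Out c"
  by (cases l rule: lab.exhaust; cases l' rule: lab.exhaust; rename_tac a b; case_tac a; case_tac b; cases c)
    (auto simp: rank_def)

lemma rank_pos: "l \<noteq> Out c \<Longrightarrow> rank c l > 0"
  by (cases c) (auto simp: rank_def split: lab.splits)

lemma rank_3_iff: "rank c l = 3 \<longleftrightarrow> l = In c"
  by (cases c) (auto simp: rank_def split: lab.splits)

lemma allowed_before_In_Blue: "allowed_succ l (In Blue) \<longleftrightarrow> l = In Blue \<or> l = Out Green"
  by (cases "(l, In Blue)" rule: allowed_succ.cases) auto

locale schnyder_map = triangulation V adj rot
  for V :: "'v set" and adj :: "'v \<Rightarrow> 'v \<Rightarrow> bool" and rot :: "'v \<Rightarrow> 'v \<Rightarrow> 'v" +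
  fixes uB uR :: 'v and out :: "'v \<Rightarrow> 'v \<Rightarrow> bool" and col :: "'v \<Rightarrow> 'v \<Rightarrow> color"
  assumes root: "adj uB uR"
    and wood: "schnyder_wood V adj rot uB uR out col"
begin

abbreviation uG :: 'v where "uG \<equiv> rot uB uR"

definition inner :: "'v set" where "inner = V - {uB, uG, uR}"

abbreviation lb :: "'v \<Rightarrow> 'v \<Rightarrow> lab" where "lb \<equiv> lab out col"

lemma outer_triangle:
  "adj uR uB" "adj uB uG" "adj uG uB" "adj uG uR" "adj uR uG" "rot uG uB = uR" "rot uR uG = uB"
  "uB \<noteq> uR" "uB \<noteq> uG" "uG \<noteq> uR"
  using triangle[OF adjD(4)[OF root]] adjD[OF root] by auto

lemma outer_vs_eq: "outer_vs rot uB uR = {uB, uG, uR}"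
  by (simp add: outer_vs_def)

lemma outer_in_V: "uB \<in> V" "uG \<in> V" "uR \<in> V"
  using outer_triangle adjD by blast+

lemma innerD: "v \<in> inner \<Longrightarrow> v \<in> V \<and> v \<noteq> uB \<and> v \<noteq> uG \<and> v \<noteq> uR"
  by (auto simp: inner_def)

lemma finite_inner: "finite inner"
  using finite_V by (simp add: inner_def)

lemma outer_face_eq: "outer_face rot uB uR = {(uR, uB), (uB, uG), (uG, uR)}"
  using fc_eq[OF outer_triangle(1)] by (simp add: outer_face_def)

lemma inner_edge_iff:
  "inner_edge adj rot uB uR u w \<longleftrightarrow> adj u w \<and> (u \<in> inner \<or> w \<in> inner)"
  unfolding inner_edge_def outer_vs_eq inner_def using adjD by blast

lemma out_flip:
  assumes "v \<in> inner" "adj v w"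
  shows "out w v \<longleftrightarrow> \<not> out v w" "col w v = col v w"
proof -
  have "inner_edge adj rot uB uR v w" using assms inner_edge_iff by blast
  moreover have "\<forall>u w. inner_edge adj rot uB uR u w \<longrightarrow> (out u w \<longleftrightarrow> \<not> out w u) \<and> col u w = col w u"
    using wood unfolding schnyder_wood_def by (elim conjE)
  ultimately have "(out v w \<longleftrightarrow> \<not> out w v) \<and> col v w = col w v" by blast
  then show "out w v \<longleftrightarrow> \<not> out v w" "col w v = col v w" by simp_all
qed

lemma to_outer:
  assumes "v \<in> inner"
  shows "adj v uB \<Longrightarrow> out v uB \<and> col v uB = Blue"
    "adj v uG \<Longrightarrow> out v uG \<and> col v uG = Green"
    "adj v uR \<Longrightarrow> out v uR \<and> col v uR = Red"
  using wood inner_edge_iff assms unfolding schnyder_wood_def by blast+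

definition par :: "color \<Rightarrow> 'v \<Rightarrow> 'v" where
  "par c v = (THE w. adj v w \<and> out v w \<and> col v w = c)"

lemma ex1_par: "v \<in> inner \<Longrightarrow> \<exists>!w. adj v w \<and> out v w \<and> col v w = c"
  using wood unfolding schnyder_wood_def outer_vs_eq inner_def by blast

lemma par:
  assumes "v \<in> inner"
  shows "adj v (par c v)" "out v (par c v)" "col v (par c v) = c"
  using theI'[OF ex1_par[OF assms, of c]] unfolding par_def by auto

lemma par_eqI: "v \<in> inner \<Longrightarrow> adj v w \<Longrightarrow> out v w \<Longrightarrow> par (col v w) v = w"
  using ex1_par[of v "col v w"] par[of v "col v w"] by blast

lemma lb_Out: "v \<in> inner \<Longrightarrow> adj v w \<Longrightarrow> lb v w = Out c \<longleftrightarrow> w = par c v"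
  using par[of v c] par_eqI[of v w] by (auto simp: lab_def)

lemma lb_In: "v \<in> inner \<Longrightarrow> adj v w \<Longrightarrow> lb v w = In c \<longleftrightarrow> out w v \<and> col w v = c"
  using out_flip[of v w] by (auto simp: lab_def)

lemma In_inner:
  assumes "v \<in> inner" "adj v w" "lb v w = In c"
  shows "w \<in> inner" "par c w = v"
proof -
  have "out w v" "col w v = c" using lb_In assms by auto
  then show 1: "w \<in> inner"
    using to_outer[OF assms(1)] out_flip[OF assms(1,2)] assms(2) adjD[OF assms(2)] unfolding inner_def by blast
  show "par c w = v" using par_eqI[OF 1, of v] \<open>out w v\<close> \<open>col w v = c\<close> assms adjD by blast
qed

lemma lb_par_In: "w \<in> inner \<Longrightarrow> par c w \<in> inner \<Longrightarrow> lb (par c w) w = In c"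
  using lb_In[of "par c w" w c] par[of w c] adjD by blast

lemma par_par_neq: "v \<in> inner \<Longrightarrow> par c v \<in> inner \<Longrightarrow> par c (par c v) \<noteq> v"
  using out_flip(1)[of v "par c v"] par[of v c] par[of "par c v" c] by metis

lemma allowed: "v \<in> inner \<Longrightarrow> adj v w \<Longrightarrow> allowed_succ (lb v w) (lb v (rot v w))"
  using wood unfolding schnyder_wood_def outer_vs_eq inner_def by blast

text \<open>\<open>Out c\<close> occurs only once around \<open>v\<close>, so during one turn
  starting there the rank never drops: the neighbours come sector by sector, and labels can be
  compared through indices.\<close>

lemma rank_enumeration:
  fixes c :: color
  assumes v: "v \<in> inner"
  defines "nb \<equiv> \<lambda>j. (rot v ^^ j) (par c v)"
  obtains d where "d > 0" "nb d = par c v" "inj_on nb {..<d}" "nb ` {..<d} = {w. adj v w}"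
    "\<And>i j. i \<le> j \<Longrightarrow> j < d \<Longrightarrow> rank c (lb v (nb i)) \<le> rank c (lb v (nb j))"
    "\<And>j. 0 < j \<Longrightarrow> j < d \<Longrightarrow> rank c (lb v (nb j)) > 0"
proof -
  obtain d where d: "d > 0" "nb d = par c v" "inj_on nb {..<d}" "nb ` {..<d} = {w. adj v w}"
    using nbr_enumeration[OF par(1)[OF v, of c]] unfolding nb_def by metis
  have adj_nb: "adj v (nb j)" for j
    using par[OF v] adj_funpow_rot unfolding nb_def by blast
  have pos: "lb v (nb j) \<noteq> Out c" if "0 < j" "j < d" for j
  proof
    assume "lb v (nb j) = Out c"
    then have "nb j = nb 0" using lb_Out v adj_nb unfolding nb_def by auto
    then show False using inj_onD[OF d(3), of j 0] that by auto
  qed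
  have mono: "rank c (lb v (nb i)) \<le> rank c (lb v (nb j))" if "i \<le> j" "j < d" for i j
    using that
  proof (induction j rule: dec_induct)
    case (step j)
    have "allowed_succ (lb v (nb j)) (lb v (nb (Suc j)))"
      using allowed[OF v adj_nb[of j]] by (simp add: nb_def)
    then show ?case using allowed_succ_rank[of _ _ c] pos[of "Suc j"] step by fastforce
  qed simp
  show ?thesis by (rule that[OF d mono]) (use pos rank_pos in auto)
qed

section \<open>Acyclicity of the monochromatic trees\<close>

text \<open>\<open>par\<close> is specified only at inner vertices, so the whole orbit is required
  to stay there.\<close>

definition mono_cycle :: "color \<Rightarrow> 'v \<Rightarrow> bool" where
  "mono_cycle c v \<longleftrightarrow> (\<exists>m>0. (par c ^^ m) v = v) \<and> (\<forall>k. (par c ^^ k) v \<in> inner)"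

definition cyc :: "color \<Rightarrow> 'v \<Rightarrow> 'v set" where
  "cyc c v = range (\<lambda>k. (par c ^^ k) v)"

definition cyc_edges :: "color \<Rightarrow> 'v \<Rightarrow> 'v set set" where
  "cyc_edges c v = (\<lambda>x. {x, par c x}) ` cyc c v"

text \<open>The substitute for a union of sides of the closed curve \<open>K\<close>: membership in
  \<open>A\<close> may change only across \<open>K\<close>. Nothing is said about \<open>A\<close>
  being connected.\<close>

definition cut_in :: "('v \<times> 'v) set set \<Rightarrow> 'v set set \<Rightarrow> bool" where
  "cut_in A K \<longleftrightarrow> (\<forall>u w. adj u w \<longrightarrow> {u, w} \<notin> K \<longrightarrow> (fc u w \<in> A \<longleftrightarrow> fc w u \<in> A))"

lemma cut_inD: "cut_in A K \<Longrightarrow> adj u w \<Longrightarrow> {u, w} \<notin> K \<Longrightarrow> fc u w \<in> A \<longleftrightarrow> fc w u \<in> A"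
  unfolding cut_in_def by blast

lemma cyc_props:
  assumes "mono_cycle c v"
  shows "v \<in> cyc c v" "cyc c v \<subseteq> inner" "x \<in> cyc c v \<Longrightarrow> par c x \<in> cyc c v"
    "x \<in> cyc c v \<Longrightarrow> \<exists>b\<in>cyc c v. par c b = x" "inj_on (par c) (cyc c v)"
proof -
  obtain m where m: "m > 0" "(par c ^^ m) v = v" using assms mono_cycle_def by blast
  have "(par c ^^ 0) v \<in> cyc c v" unfolding cyc_def by blast
  then show "v \<in> cyc c v" by simp
  show sub: "cyc c v \<subseteq> inner" using assms unfolding cyc_def mono_cycle_def by blast
  have "(par c ^^ Suc k) v \<in> cyc c v" for k unfolding cyc_def by blast
  then show step: "par c x \<in> cyc c v" if "x \<in> cyc c v" for x using that unfolding cyc_def by auto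
  show surj: "\<exists>b\<in>cyc c v. par c b = x" if "x \<in> cyc c v" for x
  proof -
    obtain k where k: "x = (par c ^^ k) v" using \<open>x \<in> cyc c v\<close> unfolding cyc_def by auto
    have "(par c ^^ (k + m)) v = x" unfolding k by (simp add: funpow_add m)
    moreover have "k + m = Suc (k + m - 1)" using m by simp
    ultimately have "par c ((par c ^^ (k + m - 1)) v) = x" by (metis funpow.simps(2) o_apply)
    then show ?thesis unfolding cyc_def by blast
  qed
  show "inj_on (par c) (cyc c v)"
    by (rule finite_surj_inj) (use finite_subset[OF sub finite_inner] surj in blast)+
qed

text \<open>Turn clockwise around \<open>x\<close> from its outgoing cycle edge. Up to
  \<open>b\<close> one stays on the right of the cycle, after \<open>b\<close> on its left, and no
  other edge can change membership in \<open>A\<close>. In the rank order \<open>b\<close> has rank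
  3, so \<open>Out (nxt c)\<close> and \<open>In (prv c)\<close> fall on the right,
  \<open>Out (prv c)\<close> and \<open>In (nxt c)\<close> on the left.\<close>

lemma cyc_turn:
  assumes mc: "mono_cycle c v" and cut: "cut_in A (cyc_edges c v)"
    and b: "b \<in> cyc c v" and x: "x = par c b"
  shows "fc (par c x) x \<in> A \<longleftrightarrow> fc x b \<in> A"
    and "fc x (par c x) \<in> A \<longleftrightarrow> fc b x \<in> A"
    and "\<And>w. adj x w \<Longrightarrow> lb x w = Out (nxt c) \<or> lb x w = In (prv c) \<Longrightarrow>
           (fc x w \<in> A \<longleftrightarrow> fc (par c x) x \<in> A) \<and> (fc w x \<in> A \<longleftrightarrow> fc (par c x) x \<in> A)"
    and "\<And>w. adj x w \<Longrightarrow> lb x w = Out (prv c) \<or> lb x w = In (nxt c) \<Longrightarrow>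
           (fc x w \<in> A \<longleftrightarrow> fc x (par c x) \<in> A) \<and> (fc w x \<in> A \<longleftrightarrow> fc x (par c x) \<in> A)"
proof -
  note cp = cyc_props[OF mc]
  have xZ: "x \<in> cyc c v" using cp(3) b x by blast
  then have xi: "x \<in> inner" and bi: "b \<in> inner" using cp b by blast+
  define nb where "nb = (\<lambda>j. (rot x ^^ j) (par c x))"
  obtain d where d: "d > 0" "nb d = par c x" "inj_on nb {..<d}" "nb ` {..<d} = {w. adj x w}"
    "\<And>i j. i \<le> j \<Longrightarrow> j < d \<Longrightarrow> rank c (lb x (nb i)) \<le> rank c (lb x (nb j))"
    using rank_enumeration[OF xi, of c] unfolding nb_def by metis
  have anb: "adj x (nb j)" for j using par[OF xi] adj_funpow_rot unfolding nb_def by blast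
  have nbS: "fc x (nb (Suc j)) = fc (nb j) x" for j
    using fc_step[of "nb j" x] adjD(4)[OF anb[of j]] by (simp add: nb_def)
  have nb0: "nb 0 = par c x" by (simp add: nb_def)
  have xb: "adj x b" "lb x b = In c" using par[OF bi] lb_par_In[OF bi] xi adjD x by auto
  then obtain m where m: "m < d" "nb m = b" using d(4) by (metis imageE lessThan_iff mem_Collect_eq)
  have "lb x (nb 0) = Out c" using lb_Out[OF xi] par[OF xi] nb0 by simp
  then have "m \<noteq> 0" using xb m by (metis lab.distinct(1))
  \<comment> \<open>The only cycle edges at \<open>x\<close> lead to \<open>par c x\<close> and to
    \<open>b\<close>, because \<open>par c\<close> is injective on the cycle.\<close>
  have off: "fc x (nb j) \<in> A \<longleftrightarrow> fc (nb j) x \<in> A" if j: "0 < j" "j < d" "j \<noteq> m" for j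
  proof (rule cut_inD[OF cut anb], rule notI)
    assume "{x, nb j} \<in> cyc_edges c v"
    then obtain y where y: "y \<in> cyc c v" "{x, nb j} = {y, par c y}" unfolding cyc_edges_def by blast
    then consider "y = x" "nb j = nb 0" | "nb j = y" "par c y = x" using nb0 by (auto simp: doubleton_eq_iff)
    then show False
    proof cases
      case 1 then show False using inj_onD[OF d(3), of j 0] j by auto
    next
      case 2
      then have "y = b" using cp(5) y(1) b x by (auto simp: inj_on_def)
      then have "nb j = nb m" using 2 m by simp
      then show False using inj_onD[OF d(3), of j m] j m by auto
    qed
  qed
  have right: "fc x (nb (Suc j)) \<in> A \<longleftrightarrow> fc (par c x) x \<in> A" if "j < m" for j
    using that
  proof (induction j)
    case 0 show ?case using nbS[of 0] nb0 by simp
  next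
    case (Suc j) then show ?case using nbS[of "Suc j"] off[of "Suc j"] m by simp
  qed
  have left: "fc x (nb (Suc j)) \<in> A \<longleftrightarrow> fc b x \<in> A" if "m \<le> j" "j < d" for j
    using that
  proof (induction j rule: dec_induct)
    case base show ?case using nbS[of m] m by simp
  next
    case (step j) then show ?case using nbS[of "Suc j"] off[of "Suc j"] by simp
  qed
  show "fc (par c x) x \<in> A \<longleftrightarrow> fc x b \<in> A"
    using right[of "m - 1"] m \<open>m \<noteq> 0\<close> by simp
  show L: "fc x (par c x) \<in> A \<longleftrightarrow> fc b x \<in> A"
    using left[of "d - 1"] m d(2) by simp
  show "(fc x w \<in> A \<longleftrightarrow> fc (par c x) x \<in> A) \<and> (fc w x \<in> A \<longleftrightarrow> fc (par c x) x \<in> A)"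
    if w: "adj x w" "lb x w = Out (nxt c) \<or> lb x w = In (prv c)" for w
  proof -
    obtain j where j: "j < d" "nb j = w" using d(4) w by (metis imageE lessThan_iff mem_Collect_eq)
    have r: "rank c (lb x w) < 3" "rank c (lb x w) \<noteq> 0" using w by auto
    then have "j \<noteq> 0" using nb0 j \<open>lb x (nb 0) = Out c\<close> by (metis rank_simps(1))
    have "j < m" using d(5)[of m j] r xb m j by (metis leD not_less rank_simps(4))
    then show ?thesis using right[of j] right[of "j - 1"] nbS[of j] j \<open>j \<noteq> 0\<close> by simp
  qed
  show "(fc x w \<in> A \<longleftrightarrow> fc x (par c x) \<in> A) \<and> (fc w x \<in> A \<longleftrightarrow> fc x (par c x) \<in> A)"
    if w: "adj x w" "lb x w = Out (prv c) \<or> lb x w = In (nxt c)" for w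
  proof -
    obtain j where j: "j < d" "nb j = w" using d(4) w by (metis imageE lessThan_iff mem_Collect_eq)
    have r: "3 < rank c (lb x w)" using w by auto
    have "m < j" using d(5)[of j m] r xb m j by (metis leD not_less rank_simps(4))
    then show ?thesis using left[of j] left[of "j - 1"] nbS[of j] j L by simp
  qed
qed

text \<open>By \<open>cyc_turn\<close>, membership in \<open>A\<close> is constant along the left
  side and along the right side. By \<open>dual_connected\<close> it changes across some cycle edge,
  hence across all of them.\<close>

lemma cyc_two_sided:
  assumes mc: "mono_cycle c v" and cut: "cut_in A (cyc_edges c v)"
    and A: "A \<noteq> {}" "A \<subset> Fs" and x: "x \<in> cyc c v"
  shows "fc (par c x) x \<in> A \<longleftrightarrow> fc (par c v) v \<in> A"
    and "fc x (par c x) \<in> A \<longleftrightarrow> fc (par c v) v \<notin> A"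
proof -
  note cp = cyc_props[OF mc]
  have same: "(fc (par c y) y \<in> A \<longleftrightarrow> fc (par c v) v \<in> A) \<and>
      (fc y (par c y) \<in> A \<longleftrightarrow> fc v (par c v) \<in> A)" if y: "y \<in> cyc c v" for y
  proof -
    obtain k where k: "y = (par c ^^ k) v" using y unfolding cyc_def by blast
    show ?thesis unfolding k
    proof (induction k)
      case (Suc k)
      have "(par c ^^ k) v \<in> cyc c v" unfolding cyc_def by blast
      from cyc_turn(1,2)[OF mc cut this refl] Suc show ?case by simp
    qed simp
  qed
  obtain u w where uw: "adj u w" "fc u w \<in> A" "fc w u \<notin> A" using dual_connected A by blast
  then have "{u, w} \<in> cyc_edges c v" using cut cut_inD by blast
  then obtain y where y: "y \<in> cyc c v" "{u, w} = {y, par c y}" unfolding cyc_edges_def by blast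
  then have "fc (par c y) y \<in> A \<longleftrightarrow> fc y (par c y) \<notin> A"
    using uw by (auto simp: doubleton_eq_iff)
  then show "fc (par c x) x \<in> A \<longleftrightarrow> fc (par c v) v \<in> A"
    "fc x (par c x) \<in> A \<longleftrightarrow> fc (par c v) v \<notin> A"
    using same[OF x] same[OF y(1)] by blast+
qed

text \<open>In \<open>jordan\<close> the edge \<open>e0\<close> is the one from \<open>v\<close> to
  \<open>par c v\<close>: the rest of the cycle is a path joining its ends, so it crosses every
  vertex cut that \<open>e0\<close> crosses. If the set obtained contains the outer face, its
  complement is taken.\<close>

lemma cyc_separates:
  assumes mc: "mono_cycle c v"
  shows "\<exists>A. A \<noteq> {} \<and> A \<subset> Fs \<and> outer_face rot uB uR \<notin> A \<and> cut_in A (cyc_edges c v)"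
proof -
  note cp = cyc_props[OF mc]
  let ?p = "par c" and ?K = "cyc_edges c v"
  have KE: "?K \<subseteq> edges adj" using cp(2) par unfolding cyc_edges_def edges_def by blast
  define m where "m = (LEAST m. 0 < m \<and> (?p ^^ m) v = v)"
  have "\<exists>m. 0 < m \<and> (?p ^^ m) v = v" using mc mono_cycle_def by blast
  from LeastI_ex[OF this] have m: "0 < m" "(?p ^^ m) v = v" unfolding m_def by auto
  have least: "(?p ^^ k) v \<noteq> v" if "0 < k" "k < m" for k
    using not_less_Least[of k "\<lambda>m. 0 < m \<and> (?p ^^ m) v = v"] that unfolding m_def by blast
  have mem: "(?p ^^ k) v \<in> cyc c v" for k unfolding cyc_def by blast
  have Kk: "{(?p ^^ k) v, (?p ^^ Suc k) v} \<in> ?K" for k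
    using mem[of k] unfolding cyc_edges_def by auto
  have cross: "\<exists>u' w'. {u', w'} \<in> ?K \<and> {u', w'} \<noteq> {v, ?p v} \<and> u' \<in> S \<and> w' \<notin> S"
    if S: "v \<in> S \<longleftrightarrow> ?p v \<notin> S" for S
  proof (rule ccontr)
    assume "\<not> ?thesis"
    then have no1: "\<And>u' w'. {u', w'} \<in> ?K \<Longrightarrow> {u', w'} \<noteq> {v, ?p v} \<Longrightarrow> u' \<in> S \<Longrightarrow> w' \<in> S"
      by blast
    have no: "u' \<in> S \<longleftrightarrow> w' \<in> S" if "{u', w'} \<in> ?K" "{u', w'} \<noteq> {v, ?p v}" for u' w'
      using no1[of u' w'] no1[of w' u'] that by (simp add: insert_commute) blast
    have "(?p ^^ k) v \<in> S \<longleftrightarrow> ?p v \<in> S" if "1 \<le> k" "k \<le> m" for k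
      using that
    proof (induction k rule: dec_induct)
      case (step k)
      \<comment> \<open>Since \<open>m\<close> is the least period, a later edge could equal the
        first one only if the orbit went back along it, against the orientation.\<close>
      have "{(?p ^^ k) v, (?p ^^ Suc k) v} \<noteq> {v, ?p v}"
      proof
        assume "{(?p ^^ k) v, (?p ^^ Suc k) v} = {v, ?p v}"
        then have "?p (?p v) = v" using least[of k] step by (auto simp: doubleton_eq_iff)
        then show False using par_par_neq[of v c] cp mem by blast
      qed
      then show ?case using no[OF Kk] step by simp
    qed simp
    from this[of m] show False using m S by simp
  qed
  have "\<exists>A. A \<noteq> {} \<and> A \<subset> Fs \<and>
     (\<forall>u w. adj u w \<longrightarrow> fc u w \<in> A \<longrightarrow> fc w u \<notin> A \<longrightarrow> {u, w} \<in> ?K)"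
  proof (rule jordan[OF KE])
    show "{v, ?p v} \<in> ?K" using Kk[of 0] by simp
    show "\<exists>u' w'. {u', w'} \<in> ?K \<and> {u', w'} \<noteq> {v, ?p v} \<and> u' \<in> S \<and> w' \<notin> S"
      if "S \<subseteq> V" "{v, ?p v} = {u, w}" "u \<in> S" "w \<notin> S" for S u w
      using cross[of S] that by (auto simp: doubleton_eq_iff)
  qed
  then obtain A where A: "A \<noteq> {}" "A \<subset> Fs"
    "\<And>u w. adj u w \<Longrightarrow> fc u w \<in> A \<Longrightarrow> fc w u \<notin> A \<Longrightarrow> {u, w} \<in> ?K" by blast
  have cut: "cut_in A ?K" unfolding cut_in_def
  proof (intro allI impI)
    fix u w assume "adj u w" "{u, w} \<notin> ?K"
    then show "fc u w \<in> A \<longleftrightarrow> fc w u \<in> A"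
      using A(3)[of u w] A(3)[of w u] adjD(4)[of u w] by (auto simp: insert_commute)
  qed
  have cut': "cut_in (Fs - A) ?K" unfolding cut_in_def
  proof (intro allI impI)
    fix u w assume uw: "adj u w" "{u, w} \<notin> ?K"
    then have "fc u w \<in> Fs" "fc w u \<in> Fs" using fc_in_Fs adjD(4) by auto
    then show "fc u w \<in> Fs - A \<longleftrightarrow> fc w u \<in> Fs - A" using cut_inD[OF cut uw] by simp
  qed
  show ?thesis
  proof (cases "outer_face rot uB uR \<in> A")
    case True
    then show ?thesis using A(1,2) cut' by (intro exI[of _ "Fs - A"]) blast
  next
    case False
    then show ?thesis using A(1,2) cut by blast
  qed
qed

text \<open>Induction on the number of faces in \<open>A\<close>. The color is generalized because
  it changes in the descent; as \<open>A\<close> need not be connected, the new set of faces must be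
  shown to lie inside the old one.\<close>

lemma no_mono_cycle_aux:
  assumes "mono_cycle c v" "A \<noteq> {}" "A \<subset> Fs" "outer_face rot uB uR \<notin> A" "cut_in A (cyc_edges c v)"
  shows False
  using assms
proof (induction "card A" arbitrary: A c v rule: less_induct)
  case (less A c v)
  note mc = less.prems(1) and A = less.prems(2,3) and outer = less.prems(4) and cut = less.prems(5)
  note cp = cyc_props[OF mc]
  text \<open>Color \<open>c'\<close> leaves the cycle only into \<open>A\<close> and enters it only from outside \<open>A\<close>, so a path of
    color \<open>c'\<close> started on the cycle stays strictly inside and closes up there.\<close>
  have "\<exists>c'. c' \<noteq> c \<and> (\<forall>x\<in>cyc c v. \<forall>w. adj x w \<longrightarrow>
      (lb x w = Out c' \<longrightarrow> fc x w \<in> A \<and> fc w x \<in> A) \<and>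
      (lb x w = In c' \<longrightarrow> fc x w \<notin> A \<and> fc w x \<notin> A))"
  proof (cases "fc (par c v) v \<in> A")
    case True
    have "(lb x w = Out (nxt c) \<longrightarrow> fc x w \<in> A \<and> fc w x \<in> A) \<and>
      (lb x w = In (nxt c) \<longrightarrow> fc x w \<notin> A \<and> fc w x \<notin> A)" if x: "x \<in> cyc c v" "adj x w" for x w
    proof -
      obtain b where b: "b \<in> cyc c v" "x = par c b" using cp(4) x by blast
      show ?thesis
        using cyc_turn(3,4)[OF mc cut b x(2)] cyc_two_sided[OF mc cut A x(1)] True by blast
    qed
    moreover have "nxt c \<noteq> c" by (cases c) auto
    ultimately show ?thesis by blast
  next
    case False
    have "(lb x w = Out (prv c) \<longrightarrow> fc x w \<in> A \<and> fc w x \<in> A) \<and>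
      (lb x w = In (prv c) \<longrightarrow> fc x w \<notin> A \<and> fc w x \<notin> A)" if x: "x \<in> cyc c v" "adj x w" for x w
    proof -
      obtain b where b: "b \<in> cyc c v" "x = par c b" using cp(4) x by blast
      show ?thesis
        using cyc_turn(3,4)[OF mc cut b x(2)] cyc_two_sided[OF mc cut A x(1)] False by blast
    qed
    moreover have "prv c \<noteq> c" by (cases c) auto
    ultimately show ?thesis by blast
  qed
  then obtain c' where c': "\<And>x w. x \<in> cyc c v \<Longrightarrow> adj x w \<Longrightarrow> lb x w = Out c' \<Longrightarrow> fc x w \<in> A \<and> fc w x \<in> A"
    "\<And>x w. x \<in> cyc c v \<Longrightarrow> adj x w \<Longrightarrow> lb x w = In c' \<Longrightarrow> fc x w \<notin> A \<and> fc w x \<notin> A"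
    by blast
  define G where "G = {u \<in> V - cyc c v. \<forall>w. adj u w \<longrightarrow> fc u w \<in> A \<and> fc w u \<in> A}"
  \<comment> \<open>No cycle edge ends at a vertex off the cycle, so turning around it keeps
    membership in \<open>A\<close>: one face in \<open>A\<close> gives them all.\<close>
  have GI: "u \<in> G" if u: "u \<notin> cyc c v" "adj u w" "fc u w \<in> A" for u w
  proof -
    have off: "{u, x} \<notin> cyc_edges c v" for x
      using u(1) cp(3) unfolding cyc_edges_def by (auto simp: doubleton_eq_iff)
    have "fc u ((rot u ^^ k) w) \<in> A" for k
    proof (induction k)
      case (Suc k)
      let ?x = "(rot u ^^ k) w"
      have a: "adj u ?x" using u adj_funpow_rot by blast
      then have "fc ?x u \<in> A" using cut_inD[OF cut a off] Suc by blast
      then show ?case using fc_step[of ?x u] adjD[OF a] by simp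
    qed (use u in simp)
    then have 1: "fc u x \<in> A" if "adj u x" for x using rot_cyclic[OF u(2) that] by metis
    have "fc x u \<in> A" if "adj u x" for x using cut_inD[OF cut that off] 1 that by blast
    then show ?thesis using 1 u adjD(1) unfolding G_def by blast
  qed
  have "uR \<notin> G" "uB \<notin> G" "uG \<notin> G"
  proof -
    have "fc uR uB = outer_face rot uB uR" "fc uB uG = outer_face rot uB uR" "fc uG uR = outer_face rot uB uR"
      using fc_memD(2)[OF outer_triangle(1)] outer_face_eq unfolding outer_face_def by blast+
    then show "uR \<notin> G" "uB \<notin> G" "uG \<notin> G"
      using outer outer_triangle unfolding G_def by (metis (mono_tags, lifting) mem_Collect_eq)+
  qed
  then have Gi: "G \<subseteq> inner" unfolding G_def inner_def by blast
  \<comment> \<open>An edge of color \<open>c'\<close> with \<open>A\<close> on both sides cannot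
    end on the cycle, where it would be ingoing and thus outside \<open>A\<close>.\<close>
  have into: "par c' u \<in> G" if u: "u \<in> inner" "fc u (par c' u) \<in> A" "fc (par c' u) u \<in> A" for u
  proof (rule GI)
    show "adj (par c' u) u" using par[OF u(1)] adjD by blast
    show "par c' u \<notin> cyc c v"
    proof
      assume w: "par c' u \<in> cyc c v"
      then have "lb (par c' u) u = In c'" using lb_par_In u(1) cp(2) by blast
      then show False using c'(2)[OF w] u par[OF u(1)] adjD by blast
    qed
  qed fact
  have Gpar: "par c' u \<in> G" if "u \<in> G" for u
    using into[of u] that Gi par[of u c'] unfolding G_def by blast
  have vi: "v \<in> inner" using cp by blast
  have "lb v (par c' v) = Out c'" using lb_Out par vi by blast
  then have w0: "par c' v \<in> G" using into[OF vi] c'(1)[OF cp(1)] par[OF vi] by blast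
  define s where "s k = (par c' ^^ k) (par c' v)" for k
  have sG: "s k \<in> G" for k unfolding s_def by (induction k) (auto simp: w0 Gpar)
  have "finite G" using Gi finite_inner finite_subset by blast
  then have "\<not> inj s" using sG finite_subset[of "range s" G] finite_imageD[of s UNIV] by auto
  then obtain i j where ij: "s i = s j" "i < j" unfolding inj_def by (metis linorder_neqE_nat)
  define v' where "v' = s i"
  have it: "(par c' ^^ k) v' = s (k + i)" for k unfolding v'_def s_def by (simp add: funpow_add)
  have mc': "mono_cycle c' v'"
  proof -
    have "(par c' ^^ (j - i)) v' = v'" using it[of "j - i"] ij v'_def by simp
    then show ?thesis unfolding mono_cycle_def using it sG Gi ij(2) zero_less_diff by (metis subsetD)
  qed
  have cG: "cyc c' v' \<subseteq> G" unfolding cyc_def using it sG by auto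
  have K': "fc x y \<in> A" if xy: "{x, y} \<in> cyc_edges c' v'" for x y
  proof -
    obtain u where u: "u \<in> cyc c' v'" "{x, y} = {u, par c' u}" using xy unfolding cyc_edges_def by blast
    then have "u \<in> G" "adj u (par c' u)" using cG Gi par by blast+
    then show ?thesis using u(2) unfolding G_def by (auto simp: doubleton_eq_iff)
  qed
  obtain A' where A': "A' \<noteq> {}" "A' \<subset> Fs" "outer_face rot uB uR \<notin> A'" "cut_in A' (cyc_edges c' v')"
    using cyc_separates[OF mc'] by blast
  have outF: "outer_face rot uB uR \<in> Fs" using fc_in_Fs outer_triangle(1) unfolding outer_face_def by blast
  \<comment> \<open>Otherwise \<open>A\<close>, \<open>A' - A\<close> and the rest, which contains
    the outer face, are three disjoint nonempty sets. The new cycle has \<open>A\<close> on both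
    sides of its edges, so all three are bounded by the old cycle alone; each would then contain one
    of the two faces at the edge from \<open>v\<close> to \<open>par c v\<close>.\<close>
  have sub: "A' \<subseteq> A"
  proof (rule ccontr)
    assume n: "\<not> A' \<subseteq> A"
    define B where "B = A' - A"
    define C where "C = Fs - A - A'"
    have B: "B \<noteq> {}" "B \<subset> Fs" and C: "C \<noteq> {}" "C \<subset> Fs"
      using n A A' outer outF unfolding B_def C_def by auto
    have step: "(fc x y \<in> A \<longleftrightarrow> fc y x \<in> A) \<and> (fc x y \<in> A' - A \<longleftrightarrow> fc y x \<in> A' - A)"
      if xy: "adj x y" "{x, y} \<notin> cyc_edges c v" for x y
    proof -
      have 1: "fc x y \<in> A \<longleftrightarrow> fc y x \<in> A" using cut_inD[OF cut xy] .
      show ?thesis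
      proof (cases "{x, y} \<in> cyc_edges c' v'")
        case True
        then show ?thesis using 1 K'[of x y] K'[of y x] by (simp add: insert_commute)
      next
        case False
        then show ?thesis using 1 cut_inD[OF A'(4) xy(1) False] by blast
      qed
    qed
    have cutB: "cut_in B (cyc_edges c v)" unfolding cut_in_def B_def using step by blast
    have cutC: "cut_in C (cyc_edges c v)" unfolding cut_in_def
    proof (intro allI impI)
      fix u w assume uw: "adj u w" "{u, w} \<notin> cyc_edges c v"
      then have "fc u w \<in> Fs" "fc w u \<in> Fs" using fc_in_Fs adjD(4) by auto
      then show "fc u w \<in> C \<longleftrightarrow> fc w u \<in> C" using step[OF uw] unfolding C_def by blast
    qed
    have "fc (par c v) v \<in> A \<or> fc v (par c v) \<in> A" 
      "fc (par c v) v \<in> B \<or> fc v (par c v) \<in> B" "fc (par c v) v \<in> C \<or> fc v (par c v) \<in> C"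
      using cyc_two_sided(2)[OF mc cut A cp(1)] cyc_two_sided(2)[OF mc cutB B cp(1)]
        cyc_two_sided(2)[OF mc cutC C cp(1)] by blast+
    then show False unfolding B_def C_def by blast
  qed
  \<comment> \<open>An edge of the new cycle has \<open>A\<close> on both sides but
    \<open>A'\<close> on only one.\<close>
  have "A' \<noteq> A"
  proof -
    have "{v', par c' v'} \<in> cyc_edges c' v'"
      using cyc_props(1)[OF mc'] unfolding cyc_edges_def by blast
    then have "fc v' (par c' v') \<in> A" "fc (par c' v') v' \<in> A"
      using K'[of v' "par c' v'"] K'[of "par c' v'" v'] by (auto simp: insert_commute)
    then show ?thesis using cyc_two_sided(2)[OF mc' A'(4) A'(1,2) cyc_props(1)[OF mc']] by blast
  qed
  then have "card A' < card A"
    using sub A(2) finite_subset[OF _ finite_Fs, of A] psubset_card_mono[of A A'] by blast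
  then show False using less.hyps[OF _ mc' A'] by simp
qed

lemma no_mono_cycle: "\<not> mono_cycle c v"
  using no_mono_cycle_aux[of c v] cyc_separates[of c v] by metis

end

section \<open>Plane trees and contour words\<close>

datatype 'a rtree = Node (rt_root: 'a) (rt_children: "'a rtree list")

fun preorder :: "'a rtree \<Rightarrow> 'a list" where
  "preorder (Node y ts) = y # concat (map preorder ts)"

fun tour :: "'a \<Rightarrow> 'a rtree \<Rightarrow> ('a \<times> 'a) list" where
  "tour x (Node y ts) = (x, y) # concat (map (tour y) ts) @ [(y, x)]"

fun tree_word :: "'a rtree \<Rightarrow> letter list" where
  "tree_word (Node y ts) = N # concat (map tree_word ts) @ [E]"

text \<open>\<open>P\<close> will be a local test for being a first child. The root of the whole
  tree is left free, having no siblings in the tree.\<close>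

fun well_flagged :: "('a \<Rightarrow> bool) \<Rightarrow> 'a rtree \<Rightarrow> bool" where
  "well_flagged P (Node y ts) \<longleftrightarrow>
     (\<forall>i<length ts. P (rt_root (ts ! i)) \<longleftrightarrow> i = 0) \<and> (\<forall>t\<in>set ts. well_flagged P t)"

text \<open>\<open>x\<close> is where the walk comes from, and \<open>nx y p\<close> the neighbour
  after \<open>p\<close> around \<open>y\<close>. The list starts and ends with \<open>x\<close>
  because the tour enters from the parent and returns to it.\<close>

fun chained :: "('a \<Rightarrow> 'a \<Rightarrow> 'a) \<Rightarrow> 'a \<Rightarrow> 'a rtree \<Rightarrow> bool" where
  "chained nx x (Node y ts) \<longleftrightarrow>
     successively (\<lambda>p q. nx y p = q) (x # map rt_root ts @ [x]) \<and> (\<forall>t\<in>set ts. chained nx y t)"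

lemma root_in_preorder: "rt_root t \<in> set (preorder t)"
  by (cases t) simp

lemma preorder_nonempty [simp]: "preorder t \<noteq> []"
  by (cases t) simp

lemma length_tour: "length (tour x t) = 2 * length (preorder t)"
proof (induction t arbitrary: x)
  case (Node y ts)
  then have "length (concat (map (tour y) ts)) = 2 * length (concat (map preorder ts))"
    by (induction ts) auto
  then show ?case by simp
qed

lemma length_tour_forest:
  "length (concat (map (tour x) ts)) = 2 * length (concat (map preorder ts))"
  by (induction ts) (auto simp: length_tour)

lemma snd_tour: "snd ` set (tour x t) = insert x (set (preorder t))"
proof (induction t arbitrary: x)
  case (Node y ts)
  then have "snd ` (\<Union>t\<in>set ts. set (tour y t)) = (\<Union>t\<in>set ts. insert y (set (preorder t)))"
    by (simp add: image_UN)
  then show ?case by auto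
qed

lemma hd_tour: "hd (tour x t) = (x, rt_root t)" and last_tour: "last (tour x t) = (rt_root t, x)"
  and tour_nonempty [simp]: "tour x t \<noteq> []"
  by (cases t; simp)+

abbreviation (input) walk :: "('a \<Rightarrow> 'a \<Rightarrow> 'a) \<Rightarrow> ('a \<times> 'a) list \<Rightarrow> bool" where
  "walk nx \<equiv> successively (\<lambda>d e. e = (snd d, nx (snd d) (fst d)))"

text \<open>Entry \<open>z\<close> and exit \<open>w\<close> are kept apart: the induction moves
  \<open>z\<close> along the siblings, and at the root of the blue tree the two may be different
  vertices.\<close>

lemma walk_forest_aux:
  assumes "\<And>t. t \<in> set ts \<Longrightarrow> walk nx (tour y t)"
    and "successively (\<lambda>p q. nx y p = q) (z # map rt_root ts @ [w])"
  shows "walk nx ((z, y) # concat (map (tour y) ts) @ [(y, w)])"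
  using assms
proof (induction ts arbitrary: z)
  case (Cons t ts)
  let ?z = "rt_root t"
  have "walk nx ((?z, y) # concat (map (tour y) ts) @ [(y, w)])"
    using Cons by simp
  moreover obtain as where as: "tour y t = as @ [(?z, y)]"
    using last_tour[of y t] append_butlast_last_id[of "tour y t"] by (metis tour_nonempty)
  ultimately have "walk nx (tour y t @ concat (map (tour y) ts) @ [(y, w)])"
    using Cons.prems(1)[of t] by (auto simp: successively_append_iff)
  moreover have "nx y z = ?z" using Cons.prems(2) by simp
  ultimately show ?case by (auto simp: successively_Cons hd_tour)
qed simp

lemma walk_tour: "chained nx x t \<Longrightarrow> walk nx (tour x t)"
proof (induction t arbitrary: x)
  case (Node y ts)
  then show ?case using walk_forest_aux[of ts nx y x x] by simp
qed

lemma walk_forest: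
  assumes "\<And>t. t \<in> set ts \<Longrightarrow> chained nx y t"
    and "successively (\<lambda>p q. nx y p = q) (z # map rt_root ts @ [w])"
  shows "walk nx ((z, y) # concat (map (tour y) ts) @ [(y, w)])"
proof (rule walk_forest_aux)
  show "walk nx (tour y t)" if "t \<in> set ts" for t using that assms(1) walk_tour by metis
qed (rule assms(2))

lemma walk_eq_iterate:
  assumes "successively (\<lambda>d e. e = f d) ds"
  shows "ds = map (\<lambda>k. (f ^^ k) (hd ds)) [0..<length ds]"
proof (rule nth_equalityI)
  fix i assume "i < length ds"
  moreover have "ds ! k = (f ^^ k) (hd ds)" if "k < length ds" for k
    using that
  proof (induction k)
    case 0 then show ?case by (cases ds) auto
  next
    case (Suc k)
    have "ds = take k ds @ ds ! k # ds ! Suc k # drop (Suc (Suc k)) ds"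
      using Suc.prems by (metis Cons_nth_drop_Suc Suc_lessD id_take_nth_drop)
    then have "successively (\<lambda>d e. e = f d) (take k ds @ ds ! k # ds ! Suc k # drop (Suc (Suc k)) ds)"
      using assms by simp
    then have "ds ! Suc k = f (ds ! k)" by (simp add: successively_append_iff)
    then show ?case using Suc by simp
  qed
  ultimately show "ds ! i = map (\<lambda>k. (f ^^ k) (hd ds)) [0..<length ds] ! i" by simp
qed simp

section \<open>Order of first visits\<close>

text \<open>\<open>remdups\<close> keeps last occurrences, hence the two reversals.\<close>

definition firsts :: "'a list \<Rightarrow> 'a list" where
  "firsts xs = rev (remdups (rev xs))"

lemma firsts_snoc: "firsts (xs @ [a]) = (if a \<in> set xs then firsts xs else firsts xs @ [a])"
  by (simp add: firsts_def)

text \<open>\<open>P\<close> is what has been visited before. It contains the parent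
  \<open>x\<close>, so the steps back add nothing.\<close>

lemma firsts_tour:
  assumes "x \<in> set P" "distinct (preorder t)" "set P \<inter> set (preorder t) = {}"
  shows "firsts (P @ map snd (tour x t)) = firsts P @ preorder t"
  using assms
proof (induction t arbitrary: x P)
  case (Node y ts)
  have forest: "firsts (P @ map snd (concat (map (tour y) ts'))) = firsts P @ concat (map preorder ts')"
    if "set ts' \<subseteq> set ts" "y \<in> set P" "distinct (concat (map preorder ts'))"
      "set P \<inter> set (concat (map preorder ts')) = {}" for P ts'
    using that
  proof (induction ts' arbitrary: P)
    case (Cons t ts')
    have "firsts (P @ map snd (tour y t)) = firsts P @ preorder t"
      using Cons.prems by (intro Node.IH) auto
    moreover have "firsts ((P @ map snd (tour y t)) @ map snd (concat (map (tour y) ts')))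
        = firsts (P @ map snd (tour y t)) @ concat (map preorder ts')"
      by (rule Cons.IH) (use Cons.prems in \<open>auto simp: snd_tour\<close>)
    ultimately show ?case by simp
  qed simp
  have "firsts ((P @ [y]) @ map snd (concat (map (tour y) ts))) = firsts (P @ [y]) @ concat (map preorder ts)"
    by (rule forest) (use Node.prems in auto)
  moreover have "firsts (P @ [y]) = firsts P @ [y]" using Node.prems by (auto simp: firsts_snoc)
  moreover have "firsts (P @ map snd (tour x (Node y ts))) =
      firsts (((P @ [y]) @ map snd (concat (map (tour y) ts))) @ [x])" by simp
  ultimately show ?case using Node.prems(1) unfolding firsts_snoc by simp
qed

lemma firsts_tour_forest:
  assumes "x \<in> set P" "distinct (concat (map preorder ts))" "set P \<inter> set (concat (map preorder ts)) = {}"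
  shows "firsts (P @ map snd (concat (map (tour x) ts))) = firsts P @ concat (map preorder ts)"
  using assms
proof (induction ts arbitrary: P)
  case (Cons t ts)
  have "firsts ((P @ map snd (tour x t)) @ map snd (concat (map (tour x) ts)))
      = firsts (P @ map snd (tour x t)) @ concat (map preorder ts)"
    by (rule Cons.IH) (use Cons.prems in \<open>auto simp: snd_tour\<close>)
  then show ?case using firsts_tour[of x P t] Cons.prems by auto
qed simp

section \<open>Canopies of tree words\<close>

text \<open>The canopy as truth values. Prefixing \<open>E\<close> just makes the first entry
  \<open>False\<close>, so no run length has to be computed.\<close>

definition zero_runs :: "letter list \<Rightarrow> bool list" where
  "zero_runs w = map (\<lambda>a. a = 0) (eruns w)"

lemma eruns_nonempty [simp]: "eruns w \<noteq> []"
  by (induction w rule: eruns.induct) (auto split: list.split)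

lemma zero_runs_simps [simp]:
  "zero_runs [] = [True]" "zero_runs (N # w) = True # zero_runs w"
  "zero_runs (E # w) = False # tl (zero_runs w)"
  by (auto simp: zero_runs_def map_tl split: list.split)

lemma canopy_nth: "r < length (zero_runs w) \<Longrightarrow> canopy w ! r = (if zero_runs w ! r then E else N)"
  by (auto simp: canopy_def zero_runs_def)

text \<open>The \<open>N\<close> visiting a first child directly follows the \<open>N\<close> of its
  parent; the \<open>N\<close> of a later child follows the \<open>E\<close> closing its elder
  sibling. \<open>w\<close> is the rest of the word.\<close>

lemma zero_runs_forest_aux:
  assumes "\<And>t w. t \<in> set ts \<Longrightarrow>
      zero_runs (tree_word t @ w) = True # map P (tl (preorder t)) @ False # tl (zero_runs w)"
    and "\<And>i. i < length ts \<Longrightarrow> P (rt_root (ts ! i)) \<longleftrightarrow> i = 0"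
  shows "zero_runs (concat (map tree_word ts) @ w) = map P (concat (map preorder ts)) @
    (if ts = [] then zero_runs w else False # tl (zero_runs w))"
proof -
  \<comment> \<open>The closing \<open>E\<close> of a tree overwrites the first entry of whatever
    follows, so the induction is about tails; \<open>False\<close> is the right entry for the next
    root, which is not a first child.\<close>
  have tail: "tl (zero_runs (concat (map tree_word ts') @ w)) =
     map P (tl (concat (map preorder ts'))) @ (if ts' = [] then [] else [False]) @ tl (zero_runs w)"
    if "\<forall>t\<in>set ts'. t \<in> set ts" "\<forall>t\<in>set (tl ts'). \<not> P (rt_root t)" for ts'
    using that
  proof (induction ts')
    case (Cons t ts')
    have IH: "tl (zero_runs (concat (map tree_word ts') @ w)) =
      map P (tl (concat (map preorder ts'))) @ (if ts' = [] then [] else [False]) @ tl (zero_runs w)"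
      by (rule Cons.IH) (use Cons.prems in simp, cases ts', use Cons.prems in auto)
    show ?case
    proof (cases ts')
      case Nil
      then show ?thesis using assms(1) Cons.prems by simp
    next
      case (Cons t' ts'')
      then have "\<not> P (rt_root t')" using Cons.prems by simp
      then have "map P (concat (map preorder ts')) = False # map P (tl (concat (map preorder ts')))"
        using Cons by (cases t') auto
      then show ?thesis using assms(1)[of t] Cons.prems IH Cons by simp
    qed
  qed simp
  show ?thesis
  proof (cases ts)
    case (Cons t ts')
    have "\<not> P (rt_root u)" if "u \<in> set ts'" for u
      using that assms(2)[of "Suc i" for i] Cons by (auto simp: in_set_conv_nth)
    moreover have "P (rt_root t)" using assms(2)[of 0] Cons by simp
    moreover have "zero_runs (concat (map tree_word ts) @ w) = True # tl (zero_runs (concat (map tree_word ts) @ w))"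
      using assms(1)[of t] Cons by simp
    ultimately show ?thesis using tail[of ts] Cons by (cases t) auto
  qed simp
qed

lemma zero_runs_tree:
  "well_flagged P t \<Longrightarrow>
     zero_runs (tree_word t @ w) = True # map P (tl (preorder t)) @ False # tl (zero_runs w)"
proof (induction t arbitrary: w)
  case (Node y ts)
  then have "zero_runs (concat (map tree_word ts) @ E # w) = map P (concat (map preorder ts)) @
    (if ts = [] then zero_runs (E # w) else False # tl (zero_runs (E # w)))"
    by (intro zero_runs_forest_aux) auto
  then show ?case by simp
qed

text \<open>The extra entry is the run after the last \<open>N\<close>. It becomes the position of
  \<open>uR\<close>.\<close>

lemma zero_runs_forest:
  assumes "well_flagged P (Node y ts)"
  shows "zero_runs (concat (map tree_word ts)) = map P (concat (map preorder ts)) @ [ts = []]"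
proof -
  have "zero_runs (concat (map tree_word ts) @ []) = map P (concat (map preorder ts)) @
    (if ts = [] then zero_runs [] else False # tl (zero_runs []))"
  proof (rule zero_runs_forest_aux)
    show "zero_runs (tree_word t @ w) = True # map P (tl (preorder t)) @ False # tl (zero_runs w)"
      if "t \<in> set ts" for t w using that assms by (intro zero_runs_tree) simp
  qed (use assms in auto)
  then show ?thesis by (simp split: if_splits)
qed

lemma eruns_replicate: "eruns (replicate k E @ w) = (k + hd (eruns w)) # tl (eruns w)"
proof (induction k)
  case (Suc k) then show ?case by (simp split: list.split)
qed simp

lemma eruns_concat: "eruns (concat (map (\<lambda>r. N # replicate (f r) E) rs)) = 0 # map f rs"
  by (induction rs) (auto simp: eruns_replicate)

text \<open>Meant for \<open>P\<close> selecting the tree neighbours in rotation order and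
  \<open>R\<close> saying that \<open>cw_next\<close> leads from one to the next. The start
  \<open>i\<close> is exempt from \<open>P\<close>: around \<open>uB\<close> it stands for
  \<open>uR\<close>, which is not a neighbour in \<open>T0\<close>.\<close>

lemma successively_filter_upt:
  assumes "i < d" "\<And>i j. i < j \<Longrightarrow> j \<le> d \<Longrightarrow> P j \<Longrightarrow> (\<And>k. i < k \<Longrightarrow> k < j \<Longrightarrow> \<not> P k) \<Longrightarrow> R i j"
  shows "successively R (i # filter P [Suc i..<Suc d])"
  using assms(1)
proof (induction "d - i" arbitrary: i rule: less_induct)
  case (less i)
  have "successively R (i # filter P [j..<Suc d])"
    if "i < j" "j \<le> Suc d" "\<And>k. i < k \<Longrightarrow> k < j \<Longrightarrow> \<not> P k" for j
    using that
  proof (induction "Suc d - j" arbitrary: j)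
    case (Suc n)
    then have jd: "j \<le> d" by simp
    then have upt: "[j..<Suc d] = j # [Suc j..<Suc d]" by (intro upt_conv_Cons) simp
    show ?case
    proof (cases "P j")
      case True
      have "successively R (j # filter P [Suc j..<Suc d])"
      proof (cases "j = d")
        case False
        then show ?thesis using jd Suc.prems(1) less.prems by (intro less.hyps) auto
      qed simp
      then show ?thesis using True jd assms(2)[of i j] Suc.prems unfolding upt by simp
    next
      case False
      then have "successively R (i # filter P [Suc j..<Suc d])"
        using Suc jd by (intro Suc.hyps) (auto simp: less_Suc_eq)
      then show ?thesis using False unfolding upt by simp
    qed
  qed simp
  from this[of "Suc i"] show ?case using less.prems by simp
qed

context schnyder_map begin

section \<open>The blue tree\<close>

definition child :: "'v \<Rightarrow> 'v \<Rightarrow> bool" where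
  "child y c \<longleftrightarrow> c \<in> inner \<and> par Blue c = y"

text \<open>\<open>rot c (par Blue c)\<close> closes the triangle on the left of the edge from the
  parent to \<open>c\<close>, so it is the neighbour of the parent just before \<open>c\<close>. By
  the order of labels, that edge leaves the parent iff it does not come from an elder
  sibling.\<close>

definition first_child :: "'v \<Rightarrow> bool" where
  "first_child c \<longleftrightarrow> ori rot uB uR out (par Blue c) (rot c (par Blue c))"

abbreviation T0 :: "'v \<Rightarrow> 'v \<Rightarrow> bool" where "T0 \<equiv> blue_tree0 adj rot uB uR col"
abbreviation T :: "'v \<Rightarrow> 'v \<Rightarrow> bool" where "T \<equiv> blue_tree adj rot uB uR col"

lemma child_inner: "child y c \<Longrightarrow> c \<in> inner"
  by (simp add: child_def)

lemma child_adj: "child y c \<Longrightarrow> adj y c \<and> adj c y"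
  using par(1)[of c Blue] adjD(4) unfolding child_def by blast

lemma child_iff_In: "y \<in> inner \<Longrightarrow> child y w \<longleftrightarrow> adj y w \<and> lb y w = In Blue"
proof
  assume "y \<in> inner" "child y w"
  then show "adj y w \<and> lb y w = In Blue" using lb_par_In[of w Blue] child_adj[of y w] by (simp add: child_def)
next
  assume "y \<in> inner" "adj y w \<and> lb y w = In Blue"
  then show "child y w" using In_inner[of y w Blue] by (simp add: child_def)
qed

lemma child_uB: "child uB w \<longleftrightarrow> adj uB w \<and> w \<in> inner"
proof
  assume w: "adj uB w \<and> w \<in> inner"
  then have "adj w uB" using adjD by blast
  then show "child uB w" using to_outer(1)[of w] par_eqI[of w uB] w unfolding child_def by auto
qed (simp add: child_adj child_inner)

lemma T0_uB: "T0 uB w \<longleftrightarrow> child uB w"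
proof -
  have "uB \<notin> inner" by (simp add: inner_def)
  then have "T0 uB w \<longleftrightarrow> adj uB w \<and> w \<in> inner \<and> col uB w = Blue"
    unfolding blue_tree0_def inner_edge_iff by blast
  moreover have "col uB w = Blue" if "adj uB w" "w \<in> inner"
    using to_outer(1)[of w] out_flip(2)[of w uB] that adjD by metis
  ultimately show ?thesis using child_uB by blast
qed

lemma T_uB: "T uB w \<longleftrightarrow> child uB w \<or> w = uR"
  using outer_triangle(8) unfolding blue_tree_def T0_uB by (auto simp: doubleton_eq_iff)

lemma T_uR: "T uR w \<longleftrightarrow> w = uB"
proof -
  have "\<not> T0 uR w"
  proof
    assume "T0 uR w"
    then have "w \<in> inner" "adj uR w" "col uR w = Blue"
      unfolding blue_tree0_def inner_edge_iff by (auto simp: inner_def)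
    then show False using to_outer(3)[of w] out_flip(2)[of w uR] adjD(4)[of uR w] by auto
  qed
  then show ?thesis using outer_triangle(8) unfolding blue_tree_def by (auto simp: doubleton_eq_iff)
qed

lemma T0_inner: "y \<in> inner \<Longrightarrow> T0 y w \<longleftrightarrow> child y w \<or> w = par Blue y"
proof -
  assume y: "y \<in> inner"
  then have "T0 y w \<longleftrightarrow> adj y w \<and> col y w = Blue" unfolding blue_tree0_def inner_edge_iff by blast
  also have "\<dots> \<longleftrightarrow> adj y w \<and> (lb y w = In Blue \<or> lb y w = Out Blue)"
    by (auto simp: lab_def)
  finally show ?thesis using lb_Out[OF y, of w Blue] child_iff_In[OF y] par(1)[OF y] by auto
qed

lemma T_inner: "y \<in> inner \<Longrightarrow> T y = T0 y"
  unfolding blue_tree_def inner_def by (auto simp: fun_eq_iff doubleton_eq_iff)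

lemma cw_next_inner: "y \<in> inner \<Longrightarrow> cw_next T0 rot y = cw_next T rot y"
  by (simp add: cw_next_def T_inner fun_eq_iff)

text \<open>Index \<open>d\<close> is included so that after a full turn the chain can close up at
  \<open>a\<close>, if \<open>a\<close> is a neighbour in the tree.\<close>

lemma cw_next_chain:
  fixes Tr :: "'v \<Rightarrow> 'v \<Rightarrow> bool" and v a :: 'v
  assumes "d > 0"
  defines "nb \<equiv> \<lambda>j. (rot v ^^ j) a"
  shows "successively (\<lambda>p q. cw_next Tr rot v p = q) (a # map nb (filter (\<lambda>j. Tr v (nb j)) [1..<Suc d]))"
proof -
  have "successively (\<lambda>i j. cw_next Tr rot v (nb i) = nb j) (0 # filter (\<lambda>j. Tr v (nb j)) [Suc 0..<Suc d])"
  proof (rule successively_filter_upt)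
    fix i j assume ij: "i < j" "Tr v (nb j)" "\<And>k. i < k \<Longrightarrow> k < j \<Longrightarrow> \<not> Tr v (nb k)"
    have it: "(rot v ^^ k) (nb i) = nb (k + i)" for k by (simp add: nb_def funpow_add)
    have "(LEAST k. 0 < k \<and> Tr v ((rot v ^^ k) (nb i))) = j - i"
    proof (rule Least_equality)
      fix k assume "0 < k \<and> Tr v ((rot v ^^ k) (nb i))"
      then have "\<not> k + i < j" using ij(3)[of "k + i"] it by auto
      then show "j - i \<le> k" by simp
    qed (use ij it in auto)
    then show "cw_next Tr rot v (nb i) = nb j" using ij(1) it by (simp add: cw_next_def)
  qed (use assms in simp)
  then have "successively (\<lambda>p q. cw_next Tr rot v p = q) (map nb (0 # filter (\<lambda>j. Tr v (nb j)) [Suc 0..<Suc d]))"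
    by (simp only: successively_map)
  then show ?thesis by (simp add: nb_def)
qed

text \<open>The neighbour from which the contour enters \<open>y\<close>; at \<open>uB\<close> the
  root corner follows the dart to \<open>uR\<close>.\<close>

definition start :: "'v \<Rightarrow> 'v" where
  "start y = (if y = uB then uR else par Blue y)"

text \<open>The chain for \<open>T0\<close> omits the return to \<open>start y\<close>, since around
  \<open>uB\<close> the edge to \<open>uR\<close> is missing there.\<close>

definition good_children :: "'v \<Rightarrow> 'v list \<Rightarrow> bool" where
  "good_children y cs \<longleftrightarrow> set cs = {c. child y c} \<and> distinct cs \<and>
     successively (\<lambda>p q. cw_next T rot y p = q) (start y # cs @ [start y]) \<and>
     successively (\<lambda>p q. cw_next T0 rot y p = q) (start y # cs) \<and>
     (\<forall>i<length cs. first_child (cs ! i) \<longleftrightarrow> i = 0)"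

text \<open>Common to inner vertices and \<open>uB\<close>: the children are consecutive in the
  rotation (\<open>contig\<close>), and the edge just before a child is outgoing exactly when it
  does not lead to another child (\<open>prev\<close>).\<close>

lemma good_children_exist_aux:
  assumes y: "y \<in> inner \<or> y = uB"
    and d: "d > 0" "nb d = start y" "inj_on nb {..<d}" "nb ` {..<d} = {w. adj y w}"
    and nb: "nb = (\<lambda>j. (rot y ^^ j) (start y))"
    and T: "\<And>w. T y w \<longleftrightarrow> child y w \<or> w = start y"
    and no0: "\<not> child y (start y)"
    and prev: "\<And>j. 0 < j \<Longrightarrow> j < d \<Longrightarrow> child y (nb j) \<Longrightarrow> ori rot uB uR out y (nb (j - 1)) \<longleftrightarrow> \<not> child y (nb (j - 1))"
    and contig: "\<And>i j. 0 < i \<Longrightarrow> i < j \<Longrightarrow> j < d \<Longrightarrow> child y (nb i) \<Longrightarrow> child y (nb j) \<Longrightarrow> child y (nb (j - 1))"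
  shows "\<exists>cs. good_children y cs"
proof -
  define js where "js = filter (\<lambda>j. child y (nb j)) [1..<d]"
  define cs where "cs = map nb js"
  have nb0: "nb 0 = start y" by (simp add: nb)
  have chain: "successively (\<lambda>p q. cw_next Tr rot y p = q)
      (start y # map nb (filter (\<lambda>j. Tr y (nb j)) [1..<Suc d]))" for Tr
    using cw_next_chain[OF d(1), where Tr = Tr and v = y and a = "start y"] unfolding nb .
  have sis: "set js = {j. 0 < j \<and> j < d \<and> child y (nb j)}" unfolding js_def by auto
  have "set cs = {c. child y c}"
  proof
    show "{c. child y c} \<subseteq> set cs"
    proof
      fix c assume "c \<in> {c. child y c}"
      then have c: "child y c" by simp
      then obtain j where j: "j < d" "nb j = c" using d(4) child_adj by (metis imageE lessThan_iff mem_Collect_eq)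
      then have "0 < j" using no0 nb0 c by (metis not_gr_zero)
      then show "c \<in> set cs" unfolding cs_def using sis j c by auto
    qed
  qed (auto simp: cs_def sis)
  moreover have "distinct cs"
  proof -
    have "inj_on nb (set js)" by (rule inj_on_subset[OF d(3)]) (auto simp: sis)
    then show ?thesis unfolding cs_def distinct_map js_def by simp
  qed
  moreover have "successively (\<lambda>p q. cw_next T rot y p = q) (start y # cs @ [start y])"
  proof -
    have "filter (\<lambda>j. T y (nb j)) [1..<d] = js"
      unfolding js_def
    proof (rule filter_cong[OF refl])
      fix j assume j: "j \<in> set [1..<d]"
      then have "nb j \<noteq> nb 0" using inj_onD[OF d(3), of j 0] by auto
      then show "T y (nb j) = child y (nb j)" unfolding T using nb0 by simp
    qed
    then have fe: "filter (\<lambda>j. T y (nb j)) [1..<Suc d] = js @ [d]" using d(1,2) T by simp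
    show ?thesis using chain[of T] d(2) unfolding fe cs_def by simp
  qed
  moreover have "successively (\<lambda>p q. cw_next T0 rot y p = q) (start y # cs)"
  proof (cases "y = uB")
    case True
    then have fe: "filter (\<lambda>j. T0 y (nb j)) [1..<Suc d] = js" using d(1,2) no0 T0_uB unfolding js_def by simp
    show ?thesis using chain[of T0] unfolding fe cs_def .
  next
    case False
    then have "cw_next T0 rot y = cw_next T rot y" using y cw_next_inner by blast
    moreover have "successively (\<lambda>p q. cw_next T rot y p = q) ((start y # cs) @ [start y])"
      using \<open>successively (\<lambda>p q. cw_next T rot y p = q) (start y # cs @ [start y])\<close> by simp
    ultimately show ?thesis unfolding successively_append_iff by simp
  qed
  moreover have "first_child (cs ! i) \<longleftrightarrow> i = 0" if i: "i < length cs" for i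
  proof -
    define j where "j = js ! i"
    have len: "i < length js" using i cs_def by simp
    then have "j \<in> set js" unfolding j_def by simp
    then have j: "0 < j" "j < d" "child y (nb j)" using sis by auto
    have csi: "cs ! i = nb j" using i unfolding cs_def j_def by simp
    \<comment> \<open>The third vertex of the triangle at \<open>y\<close> and \<open>nb j\<close>,
      the one tested by \<open>first_child\<close>.\<close>
    have "rot (nb j) y = nb (j - 1)"
    proof -
      have a: "adj y (nb j)" "adj y (nb (j - 1))" using child_adj j d(4) by auto
      have "rot y (nb (j - 1)) = nb j" using j(1) unfolding nb by (cases j) auto
      then show ?thesis using triangle(4,6)[OF a(1)] a rot_inj by metis
    qed
    then have "first_child (cs ! i) \<longleftrightarrow> \<not> child y (nb (j - 1))"
      using prev[OF j] j(3) unfolding csi first_child_def child_def by simp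
    moreover have "\<not> child y (nb (j - 1)) \<longleftrightarrow> i = 0"
    proof
      assume n: "\<not> child y (nb (j - 1))"
      show "i = 0"
      proof (rule ccontr)
        assume "i \<noteq> 0"
        have "sorted_wrt (<) js" unfolding js_def by (intro sorted_wrt_filter sorted_wrt_upt)
        then have "js ! 0 < j" unfolding j_def using \<open>i \<noteq> 0\<close> len by (simp add: sorted_wrt_nth_less)
        moreover have "js ! 0 \<in> set js" using len by (intro nth_mem) linarith
        ultimately show False using contig[of "js ! 0" j] j n sis by auto
      qed
    next
      assume i0: "i = 0"
      show "\<not> child y (nb (j - 1))"
      proof
        assume c: "child y (nb (j - 1))"
        then have "j - 1 \<noteq> 0" using no0 nb0 by metis
        then have "j - 1 \<in> set js" using sis c j by auto
        then obtain k where k: "k < length js" "js ! k = j - 1" by (metis in_set_conv_nth)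
        have "sorted js" unfolding js_def by (simp add: sorted_filter[where f = id, simplified])
        then have "js ! 0 \<le> js ! k" using k(1) by (intro sorted_nth_mono) simp_all
        then show False using k j unfolding j_def i0 by simp
      qed
    qed
    ultimately show ?thesis by simp
  qed
  ultimately show ?thesis unfolding good_children_def by blast
qed

lemma good_children_exist:
  assumes y: "y \<in> inner \<or> y = uB"
  shows "\<exists>cs. good_children y cs"
proof (cases "y = uB")
  case True
  define nb where "nb = (\<lambda>j. (rot y ^^ j) (start y))"
  have s: "start y = uR" using True by (simp add: start_def)
  obtain d where d: "d > 0" "nb d = start y" "inj_on nb {..<d}" "nb ` {..<d} = {w. adj y w}"
  proof -
    have a: "adj y (start y)" using root s True by simp
    show thesis by (rule nbr_enumeration[OF a], rule that) (simp_all only: nb_def)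
  qed
  \<comment> \<open>Around \<open>uB\<close>, positions 0 and 1 are \<open>uR\<close> and
    \<open>uG\<close>; all later neighbours are inner and therefore children.\<close>
  have nb01: "nb 0 = uR" "nb 1 = uG" using s True by (simp_all add: nb_def)
  have inn: "nb j \<in> inner" if j: "1 < j" "j < d" for j
  proof -
    have "nb j \<noteq> nb 0" "nb j \<noteq> nb 1" using inj_onD[OF d(3), of j 0] inj_onD[OF d(3), of j 1] j by auto
    moreover have "adj uB (nb j)" using d(4) j True by auto
    ultimately show ?thesis using nb01 adjD[of uB "nb j"] unfolding inner_def by auto
  qed
  have ch: "child y w \<longleftrightarrow> adj uB w \<and> w \<in> inner" for w using child_uB True by simp
  have ch1: "1 < j \<and> nb j \<in> inner" if "0 < j" "child y (nb j)" for j
    using that nb01 ch innerD by (metis less_one linorder_neqE_nat)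
  show ?thesis
  proof (rule good_children_exist_aux[OF y d nb_def])
    show "T y w \<longleftrightarrow> child y w \<or> w = start y" for w using T_uB s True by simp
    show "\<not> child y (start y)" unfolding s ch inner_def by simp
    fix j assume j: "0 < j" "j < d" "child y (nb j)"
    then have j1: "1 < j" using ch1 by blast
    show "ori rot uB uR out y (nb (j - 1)) \<longleftrightarrow> \<not> child y (nb (j - 1))"
    proof (cases "j = 2")
      case True
      then show ?thesis using \<open>y = uB\<close> nb01 ch by (simp add: ori_def outer_vs_eq inner_def)
    next
      case False
      then have i: "nb (j - 1) \<in> inner" using inn j1 j by auto
      have a: "adj uB (nb (j - 1))" using d(4) j(2) \<open>y = uB\<close> by auto
      then have "\<not> out uB (nb (j - 1))" using to_outer(1)[OF i] out_flip(1)[OF i, of uB] adjD by blast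
      then show ?thesis using i a ch \<open>y = uB\<close> innerD[OF i] by (auto simp: ori_def outer_vs_eq)
    qed
  next
    fix i j assume ij: "0 < i" "i < j" "j < d" "child y (nb i)" "child y (nb j)"
    then have "1 < j - 1" using ch1[of i] by auto
    then have "nb (j - 1) \<in> inner" using inn ij by auto
    moreover have "adj uB (nb (j - 1))" using d(4) ij(3) True by auto
    ultimately show "child y (nb (j - 1))" using ch by blast
  qed
next
  case False
  then have yi: "y \<in> inner" using y by simp
  define nb where "nb = (\<lambda>j. (rot y ^^ j) (par Blue y))"
  have s: "start y = par Blue y" using False by (simp add: start_def)
  obtain d where d: "d > 0" "nb d = par Blue y" "inj_on nb {..<d}" "nb ` {..<d} = {w. adj y w}"
    "\<And>i j. i \<le> j \<Longrightarrow> j < d \<Longrightarrow> rank Blue (lb y (nb i)) \<le> rank Blue (lb y (nb j))"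
    using rank_enumeration[OF yi, of Blue] unfolding nb_def by metis
  have adj_nb: "adj y (nb j)" for j using par[OF yi] adj_funpow_rot unfolding nb_def by blast
  have ch: "child y (nb j) \<longleftrightarrow> rank Blue (lb y (nb j)) = 3" for j
    unfolding rank_3_iff using child_iff_In[OF yi] adj_nb by blast
  show ?thesis
  proof (rule good_children_exist_aux[of y d nb])
    show "nb d = start y" "nb = (\<lambda>j. (rot y ^^ j) (start y))" using d s nb_def by simp_all
    show "T y w \<longleftrightarrow> child y w \<or> w = start y" for w using T0_inner[OF yi] T_inner[OF yi] s by simp
    have "lb y (par Blue y) = Out Blue" using lb_Out par yi by blast
    then show "\<not> child y (start y)" unfolding s child_iff_In[OF yi] by simp
    fix j assume j: "0 < j" "j < d" "child y (nb j)"
    have "rot y (nb (j - 1)) = nb j" using j(1) unfolding nb_def by (cases j) auto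
    then have "allowed_succ (lb y (nb (j - 1))) (In Blue)"
      using allowed[OF yi adj_nb[of "j - 1"]] j child_iff_In[OF yi] by simp
    then show "ori rot uB uR out y (nb (j - 1)) \<longleftrightarrow> \<not> child y (nb (j - 1))"
      using child_iff_In[OF yi] adj_nb innerD[OF yi] unfolding allowed_before_In_Blue
      by (auto simp: ori_def outer_vs_eq lab_def split: if_splits)
  next
    fix i j assume ij: "0 < i" "i < j" "j < d" "child y (nb i)" "child y (nb j)"
    show "child y (nb (j - 1))" using ij d(5)[of i "j - 1"] d(5)[of "j - 1" j] unfolding ch by simp
  qed (use y d in auto)
qed

section \<open>The blue edges as a plane tree\<close>

definition childrel :: "('v \<times> 'v) set" where
  "childrel = {(c, y). child y c}"

lemma acyclic_childrel: "acyclic childrel"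
proof (rule acyclicI, rule allI, rule notI)
  fix a assume "(a, a) \<in> childrel\<^sup>+"
  then obtain m where m: "m > 0" "(a, a) \<in> childrel ^^ m" using trancl_power by blast
  have *: "b = (par Blue ^^ n) a \<and> (\<forall>k<n. (par Blue ^^ k) a \<in> inner)" if "(a, b) \<in> childrel ^^ n" for n b
    using that
  proof (induction n arbitrary: b)
    case (Suc n)
    then obtain b' where b': "(a, b') \<in> childrel ^^ n" "child b b'" by (auto simp: childrel_def)
    show ?case using Suc.IH[OF b'(1)] b'(2) by (auto simp: child_def less_Suc_eq)
  qed simp
  have p: "(par Blue ^^ m) a = a" using *[OF m(2)] by simp
  have "(par Blue ^^ k) a \<in> inner" for k
    using *[OF m(2)] m(1) funpow_mod_eq[OF p, of k] mod_less_divisor[of m k] by metis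
  then have "mono_cycle Blue a" unfolding mono_cycle_def using m p by blast
  then show False using no_mono_cycle by blast
qed

lemma finite_childrel: "finite childrel"
  by (rule finite_subset[of _ "V \<times> V"]) (auto simp: childrel_def finite_V dest: child_adj adjD)

lemma single_valued_childrel: "single_valued childrel"
  by (auto simp: single_valued_def childrel_def child_def)

fun btree :: "'v rtree \<Rightarrow> bool" where
  "btree (Node y ts) \<longleftrightarrow> good_children y (map rt_root ts) \<and> (\<forall>t\<in>set ts. btree t)"

lemma btree_exists: "y \<in> inner \<or> y = uB \<Longrightarrow> \<exists>t. btree t \<and> rt_root t = y"
proof (induction y rule: wf_induct_rule[OF finite_acyclic_wf[OF finite_childrel acyclic_childrel]])
  case (1 y)
  obtain cs where cs: "good_children y cs" using good_children_exist 1 by blast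
  have "\<forall>c\<in>set cs. \<exists>t. btree t \<and> rt_root t = c"
    using 1 cs child_inner unfolding good_children_def childrel_def by auto
  then obtain f where f: "\<forall>c\<in>set cs. btree (f c) \<and> rt_root (f c) = c" by metis
  then have "map rt_root (map f cs) = cs" by (simp add: map_idI)
  then have "btree (Node y (map f cs))" using cs f by simp
  then show ?case by (intro exI[of _ "Node y (map f cs)"]) simp
qed

lemma set_preorder_btree: "btree t \<Longrightarrow> set (preorder t) = {v. (v, rt_root t) \<in> childrel\<^sup>*}"
proof (induction t)
  case (Node y ts)
  have ch: "child y c \<longleftrightarrow> (\<exists>t\<in>set ts. rt_root t = c)" for c
  proof -
    have "rt_root ` set ts = {c. child y c}" using Node.prems by (simp add: good_children_def)
    then show ?thesis by (metis image_iff mem_Collect_eq)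
  qed
  have "(v, y) \<in> childrel\<^sup>* \<longleftrightarrow> v = y \<or> (\<exists>c. (v, c) \<in> childrel\<^sup>* \<and> child y c)" for v
    by (subst rtrancl_unfold) (auto simp: childrel_def relcomp_unfold)
  moreover have "set (preorder t) = {v. (v, rt_root t) \<in> childrel\<^sup>*}" if "t \<in> set ts" for t
    using Node that by auto
  ultimately show ?case unfolding ch by auto
qed

text \<open>Parents are unique, so the ancestors of a vertex form a chain. A common descendant of
  two siblings would make one sibling an ancestor of the other, hence \<open>y\<close> a descendant
  of its own child.\<close>

lemma distinct_preorder_btree: "btree t \<Longrightarrow> distinct (preorder t)"
proof (induction t)
  case (Node y ts)
  have ch: "(rt_root t, y) \<in> childrel" if "t \<in> set ts" for t
    using Node.prems that by (auto simp: good_children_def childrel_def)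
  have d: "distinct ts" "inj_on rt_root (set ts)"
    using Node.prems by (auto simp: good_children_def distinct_map)
  have sp: "set (preorder t) = {v. (v, rt_root t) \<in> childrel\<^sup>*}" if "t \<in> set ts" for t
    using Node.prems that set_preorder_btree by auto
  have up: "(y, rt_root t) \<notin> childrel\<^sup>*" if "t \<in> set ts" for t
    using acyclic_childrel rtrancl_into_trancl1[OF _ ch[OF that]] unfolding acyclic_def by blast
  have noanc: "False" if t: "t \<in> set ts" "t' \<in> set ts" "t \<noteq> t'" "(rt_root t, rt_root t') \<in> childrel\<^sup>*" for t t'
  proof -
    have "rt_root t \<noteq> rt_root t'" using d t by (auto simp: inj_on_def)
    then obtain w where "(rt_root t, w) \<in> childrel" "(w, rt_root t') \<in> childrel\<^sup>*"
      using t(4) by (metis converse_rtranclE)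
    then have "(y, rt_root t') \<in> childrel\<^sup>*" using ch[OF t(1)] single_valued_childrel by (auto dest: single_valuedD)
    then show False using up t by blast
  qed
  have disj: "set (preorder t) \<inter> set (preorder t') = {}" if t: "t \<in> set ts" "t' \<in> set ts" "t \<noteq> t'" for t t'
  proof (rule ccontr)
    assume "\<not> ?thesis"
    then obtain v where "(v, rt_root t) \<in> childrel\<^sup>*" "(v, rt_root t') \<in> childrel\<^sup>*" using sp t by blast
    then show False
      using single_valued_confluent[OF single_valued_childrel] noanc t by metis
  qed
  have "distinct (concat (map preorder ts))"
  proof (rule distinct_concat)
    have "preorder t \<noteq> preorder t'" if "t \<in> set ts" "t' \<in> set ts" "t \<noteq> t'" for t t'
      using disj[OF that] root_in_preorder by fastforce
    then show "distinct (map preorder ts)" using d(1) by (auto simp: distinct_map inj_on_def)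
  qed (use Node disj in auto)
  moreover have "y \<notin> set (preorder t)" if "t \<in> set ts" for t using sp up that by blast
  ultimately show ?case by auto
qed

lemma btree_roots: "btree (Node y ts) \<Longrightarrow> t \<in> set ts \<Longrightarrow> child y (rt_root t) \<and> btree t"
  by (auto simp: good_children_def)

lemma well_flagged_btree: "btree t \<Longrightarrow> well_flagged first_child t"
  by (induction t) (auto simp: good_children_def)

lemma chained_btree: "btree t \<Longrightarrow> rt_root t \<in> inner \<Longrightarrow> chained (cw_next T rot) (par Blue (rt_root t)) t"
proof (induction t)
  case (Node y ts)
  have y: "y \<in> inner" "y \<noteq> uB" using Node.prems by (auto simp: inner_def)
  have "chained (cw_next T rot) y t" if "t \<in> set ts" for t
    using Node.IH[OF that] btree_roots[OF Node.prems(1) that] by (auto simp: child_def)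
  then show ?case using Node.prems(1) y by (simp add: good_children_def start_def)
qed

lemma chained_btree0: "btree t \<Longrightarrow> rt_root t \<in> inner \<Longrightarrow> chained (cw_next T0 rot) (par Blue (rt_root t)) t"
proof (induction t)
  case (Node y ts)
  have y: "y \<in> inner" "y \<noteq> uB" using Node.prems by (auto simp: inner_def)
  have "chained (cw_next T0 rot) y t" if "t \<in> set ts" for t
    using Node.IH[OF that] btree_roots[OF Node.prems(1) that] by (auto simp: child_def)
  then show ?case using Node.prems(1) y by (simp add: good_children_def start_def cw_next_inner)
qed

lemma tour_word:
  "btree t \<Longrightarrow> rt_root t \<in> inner \<Longrightarrow>
     map (step_letter adj rot uB uR out col) (tour (par Blue (rt_root t)) t) = tree_word t"
proof (induction t)
  case (Node y ts)
  have y: "y \<in> inner" using Node.prems by simp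
  let ?s = "step_letter adj rot uB uR out col" and ?x = "par Blue y"
  have "map ?s (concat (map (tour y) ts)) = concat (map tree_word ts)"
    unfolding map_concat map_map comp_def
    using Node.IH btree_roots[OF Node.prems(1)]
    by (intro arg_cong[where f = concat] map_cong) (auto simp: child_def)
  moreover have "?s (?x, y) = N"
    using par[OF y, of Blue] adjD(4) out_flip[OF y, of ?x] y
    by (simp add: step_letter_def blue_tree0_def inner_edge_iff)
  moreover have "?s (y, ?x) = E"
    using par[OF y, of Blue] out_flip(1)[OF y, of ?x] innerD[OF y]
    by (auto simp: step_letter_def)
  ultimately show ?case by simp
qed

lemma par_Blue_cases: "v \<in> inner \<Longrightarrow> par Blue v \<in> inner \<or> par Blue v = uB"
proof -
  assume v: "v \<in> inner"
  have "par Blue v \<noteq> uG" "par Blue v \<noteq> uR"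
    using to_outer(2,3)[OF v] par[OF v, of Blue] by (metis color.distinct)+
  then show ?thesis using adjD(2)[OF par(1)[OF v, of Blue]] unfolding inner_def by blast
qed

lemma childrel_to_uB: "v \<in> inner \<Longrightarrow> (v, uB) \<in> childrel\<^sup>*"
proof (induction v rule: wf_induct_rule[OF finite_acyclic_wf_converse[OF finite_childrel acyclic_childrel]])
  case (1 v)
  have c: "(v, par Blue v) \<in> childrel" using 1 by (auto simp: childrel_def child_def)
  show ?case using 1(1)[of "par Blue v"] c par_Blue_cases[OF 1(2)] by (auto intro: converse_rtrancl_into_rtrancl)
qed

section \<open>Faces to the left of blue edges\<close>

definition pa :: "'v \<Rightarrow> 'v" where
  "pa v = (if v = uR then uB else par Blue v)"

definition third :: "'v \<Rightarrow> 'v" where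
  "third v = rot v (pa v)"

definition red_in :: "'v \<Rightarrow> 'v set" where
  "red_in v = {w. inner_edge adj rot uB uR w v \<and> out w v \<and> col w v = Red}"

lemma pa_inner: "v \<in> inner \<Longrightarrow> pa v = par Blue v"
  by (auto simp: pa_def inner_def)

lemma pa_cases: "v \<in> inner \<Longrightarrow> pa v \<in> inner \<or> pa v = uB"
  using par_Blue_cases pa_inner by simp

lemma adj_pa: "v \<in> insert uR inner \<Longrightarrow> adj (pa v) v"
  using root par(1) adjD(4) pa_inner by (auto simp: pa_def)

lemma third_triangle:
  assumes "v \<in> insert uR inner"
  shows "adj v (third v)" "adj (third v) v" "adj (third v) (pa v)" "adj (pa v) (third v)"
    "rot (third v) v = pa v" "rot (pa v) (third v) = v" "rot v (pa v) = third v"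
    "third v \<noteq> pa v" "third v \<noteq> v"
  using triangle[OF adj_pa[OF assms]] unfolding third_def by auto

lemma child_uB_exists:
  assumes "inner \<noteq> {}"
  shows "\<exists>c. child uB c"
proof -
  obtain v where v: "v \<in> inner" using assms by blast
  then have "v \<noteq> uB" by (simp add: inner_def)
  then show ?thesis using childrel_to_uB[OF v] by (auto elim: rtranclE simp: childrel_def)
qed

text \<open>If the third vertex were \<open>uG\<close>, then \<open>rot uB\<close> would swap
  \<open>uR\<close> and \<open>uG\<close>, leaving \<open>uB\<close> without inner
  neighbours.\<close>

lemma third_uR:
  assumes "inner \<noteq> {}"
  shows "third uR \<in> inner"
proof -
  have t: "third uR \<noteq> uB" "third uR \<noteq> uR" "rot uB (third uR) = uR" "adj uR (third uR)"
    using third_triangle[of uR] by (auto simp: pa_def)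
  have "third uR \<noteq> uG"
  proof
    assume e: "third uR = uG"
    have "(rot uB ^^ k) uR \<in> {uR, uG}" for k
      using t(3) e by (induction k) auto
    moreover obtain c where "c \<in> inner" "adj uB c"
      using child_uB_exists[OF assms] child_uB by blast
    ultimately show False using rot_cyclic[OF root, of c] by (auto simp: inner_def)
  qed
  then show ?thesis using t adjD(2)[OF t(4)] unfolding inner_def by blast
qed

lemma lb_third:
  assumes "v \<in> inner"
  shows "lb v (third v) = In Red \<or> lb v (third v) = Out Green"
proof -
  have "lb v (pa v) = Out Blue" using lb_Out[OF assms] par[OF assms] pa_inner[OF assms] by simp
  then show ?thesis using allowed[OF assms, of "pa v"] par[OF assms] pa_inner[OF assms] third_triangle(7)[of v] assms
    by simp
qed

lemma third_cases:
  assumes "v \<in> insert uR inner" "inner \<noteq> {}"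
  shows "third v = uG \<or> third v \<in> inner"
proof (cases "v = uR")
  case False
  then have v: "v \<in> inner" using assms by blast
  note a = third_triangle(1)[OF assms(1)]
  have "third v \<noteq> uB" "third v \<noteq> uR"
    using to_outer(1,3)[OF v] lb_third[OF v] a by (auto simp: lab_def)
  then show ?thesis using adjD(2)[OF a] unfolding inner_def by blast
qed (use third_uR assms in blast)

lemma face_eq:
  assumes "v \<in> insert uR inner"
  shows "fc (pa v) v = {(pa v, v), (v, third v), (third v, pa v)}"
  using fc_eq[OF adj_pa[OF assms]] by (simp add: third_def)

text \<open>A corner is named by the dart that opens it clockwise: the dart to
  \<open>third v\<close> at \<open>pa v\<close>, to \<open>pa v\<close> at \<open>v\<close>, and to
  \<open>v\<close> at \<open>third v\<close>. At inner vertices the labels of these darts determine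
  the colors.\<close>

lemma face_colors:
  assumes v: "v \<in> insert uR inner" and ne: "inner \<noteq> {}"
  shows "mobile_color rot uB uR out col (pa v, v) = Blue"
    "mobile_color rot uB uR out col (v, third v) = Red"
    "mobile_color rot uB uR out col (third v, pa v) = Green"
proof -
  note t = third_triangle[OF v]
  show "mobile_color rot uB uR out col (pa v, v) = Blue"
  proof (cases "pa v = uB")
    case False
    then have vi: "v \<in> inner" using v by (auto simp: pa_def)
    then have x: "pa v \<in> inner" using pa_cases False by blast
    have "lb (pa v) v = In Blue" using lb_par_In vi x pa_inner by metis
    then have "allowed_succ (lb (pa v) (third v)) (In Blue)"
      using allowed[OF x t(4)] t(6) by simp
    then show ?thesis
      using innerD[OF x] t(7) unfolding allowed_before_In_Blue
      by (auto simp: mobile_color_def corner_color_def)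
  qed (simp add: mobile_color_def corner_color_def)
  show "mobile_color rot uB uR out col (v, third v) = Red"
  proof (cases "v = uR")
    case True
    then show ?thesis using outer_triangle(8,10) by (simp add: mobile_color_def corner_color_def)
  next
    case False
    then have vi: "v \<in> inner" using v by simp
    have "lb v (pa v) = Out Blue" using lb_Out[OF vi] par[OF vi] pa_inner[OF vi] by simp
    then show ?thesis using innerD[OF vi] t(5) by (simp add: mobile_color_def corner_color_def)
  qed
  show "mobile_color rot uB uR out col (third v, pa v) = Green"
  proof (cases "third v = uG")
    case True
    then show ?thesis using outer_triangle(9) by (simp add: mobile_color_def corner_color_def)
  next
    case False
    then have z: "third v \<in> inner" using third_cases[OF v ne] by blast
    have "lb (third v) v = Out Red \<or> lb (third v) v = In Green"
    proof (cases "v = uR")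
      case True
      then show ?thesis using to_outer(3)[OF z] t(2) by (simp add: lab_def)
    next
      case False
      then have vi: "v \<in> inner" using v by simp
      show ?thesis using lb_third[OF vi] out_flip[OF vi t(1)]
        by (auto simp: lab_def split: if_splits)
    qed
    then show ?thesis using innerD[OF z] t(6) by (auto simp: mobile_color_def corner_color_def)
  qed
qed

lemma ori_inner: "x \<in> inner \<or> y \<in> inner \<Longrightarrow> ori rot uB uR out x y = out x y"
  by (auto simp: ori_def outer_vs_eq inner_def)

lemma face_legs:
  assumes v: "v \<in> insert uR inner" and ne: "inner \<noteq> {}"
  defines "f \<equiv> fc (pa v) v"
  shows "leg_of_color rot uB uR out col f Blue"
    "leg_of_color rot uB uR out col f Red \<longleftrightarrow> ori rot uB uR out (third v) v"
    "leg_of_color rot uB uR out col f Green \<longleftrightarrow> ori rot uB uR out (pa v) (third v)"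
proof -
  note c = face_colors[OF v ne]
  have "ori rot uB uR out v (pa v)"
  proof (cases "v = uR")
    case False
    then have "v \<in> inner" using v by simp
    then show ?thesis using par pa_inner ori_inner by simp
  qed (simp add: pa_def ori_def outer_vs_eq)
  then show "leg_of_color rot uB uR out col f Blue"
    "leg_of_color rot uB uR out col f Red \<longleftrightarrow> ori rot uB uR out (third v) v"
    "leg_of_color rot uB uR out col f Green \<longleftrightarrow> ori rot uB uR out (pa v) (third v)"
    unfolding leg_of_color_def f_def face_eq[OF v] by (auto simp: c is_leg_def)
qed

text \<open>Clockwise after the outgoing blue edge of an inner vertex come the ingoing reds; if
  there are any, \<open>third v\<close> is the first. At \<open>uR\<close>, \<open>third uR\<close>
  is inner, so its edge is ingoing red.\<close>

lemma red_leg_iff: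
  assumes v: "v \<in> insert uR inner" and ne: "inner \<noteq> {}"
  shows "ori rot uB uR out (third v) v \<longleftrightarrow> red_in v \<noteq> {}"
proof (cases "v = uR")
  case True
  have z: "third uR \<in> inner" "adj (third uR) uR" using third_uR[OF ne] third_triangle(2)[of uR] by auto
  then have "third uR \<in> red_in uR" using to_outer(3)[OF z] by (simp add: red_in_def inner_edge_iff)
  moreover have "ori rot uB uR out (third uR) uR" using to_outer(3)[OF z] z ori_inner by simp
  ultimately show ?thesis using True by blast
next
  case False
  then have vi: "v \<in> inner" using v by simp
  have red: "w \<in> red_in v \<longleftrightarrow> adj v w \<and> lb v w = In Red" for w
    using lb_In[OF vi] vi adjD(4) by (auto simp: red_in_def inner_edge_iff)
  have "ori rot uB uR out (third v) v \<longleftrightarrow> lb v (third v) = In Red"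
    using lb_third[OF vi] out_flip(1)[OF vi third_triangle(1)[OF v]] vi ori_inner
    by (auto simp: lab_def split: if_splits)
  moreover have "lb v (third v) = In Red" if w: "adj v w" "lb v w = In Red" for w
  proof -
    define nb where "nb = (\<lambda>j. (rot v ^^ j) (par Blue v))"
    obtain d where d: "nb ` {..<d} = {w. adj v w}"
      "\<And>i j. i \<le> j \<Longrightarrow> j < d \<Longrightarrow> rank Blue (lb v (nb i)) \<le> rank Blue (lb v (nb j))"
      using rank_enumeration[OF vi, of Blue] unfolding nb_def by metis
    obtain j where j: "j < d" "nb j = w" using d(1) w by (metis imageE lessThan_iff mem_Collect_eq)
    have "nb 0 = par Blue v" "nb 1 = third v" using pa_inner[OF vi] by (simp_all add: nb_def third_def)
    moreover have "lb v (par Blue v) = Out Blue" using lb_Out[OF vi] par[OF vi] by simp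
    ultimately have "j \<noteq> 0" using j w by (metis lab.distinct(1))
    then have "rank Blue (lb v (third v)) \<le> rank Blue (In Red)"
      using d(2)[of 1 j] j w \<open>nb 1 = third v\<close> by simp
    then show ?thesis using lb_third[OF vi] by (auto simp: rank_def)
  qed
  ultimately show ?thesis using red third_triangle(1)[OF v] by blast
qed

text \<open>For inner \<open>v\<close> this is the definition of \<open>first_child\<close>. At
  \<open>uR\<close> the third vertex is the last child of \<open>uB\<close>, and its edge enters
  \<open>uB\<close>; correspondingly the contour word ends with \<open>E\<close>.\<close>

lemma green_leg_iff:
  assumes v: "v \<in> insert uR inner" and ne: "inner \<noteq> {}"
  shows "ori rot uB uR out (pa v) (third v) \<longleftrightarrow> v \<noteq> uR \<and> first_child v"
proof (cases "v = uR")
  case True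
  have z: "third uR \<in> inner" "adj (third uR) uB" using third_uR[OF ne] third_triangle(3)[of uR] by (auto simp: pa_def)
  then have "\<not> out uB (third uR)" using to_outer(1)[OF z] out_flip(1)[OF z] by simp
  then show ?thesis using True z(1) ori_inner by (simp add: pa_def)
next
  case False
  then show ?thesis using v pa_inner by (simp add: first_child_def third_def)
qed

lemma blue_leg_nodes_eq:
  assumes ne: "inner \<noteq> {}"
  shows "blue_leg_nodes adj rot uB uR out col = (\<lambda>v. fc (pa v) v) ` insert uR inner"
proof
  show "(\<lambda>v. fc (pa v) v) ` insert uR inner \<subseteq> blue_leg_nodes adj rot uB uR out col"
  proof
    fix f assume "f \<in> (\<lambda>v. fc (pa v) v) ` insert uR inner"
    then obtain v where v: "v \<in> insert uR inner" "f = fc (pa v) v" by blast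
    have "(pa v, v) \<notin> outer_face rot uB uR"
      using v(1) outer_triangle(8,9,10) unfolding outer_face_eq by (auto simp: inner_def pa_def)
    then have "f \<noteq> outer_face rot uB uR" using fc_mem[OF adj_pa[OF v(1)]] v(2) by auto
    then show "f \<in> blue_leg_nodes adj rot uB uR out col"
      unfolding blue_leg_nodes_def inner_faces_def
      using face_legs(1)[OF v(1) ne] fc_in_Fs[OF adj_pa[OF v(1)]] v(2) by simp
  qed
  show "blue_leg_nodes adj rot uB uR out col \<subseteq> (\<lambda>v. fc (pa v) v) ` insert uR inner"
  proof
    fix f assume "f \<in> blue_leg_nodes adj rot uB uR out col"
    then have f: "f \<in> Fs" "f \<noteq> outer_face rot uB uR" "leg_of_color rot uB uR out col f Blue"
      unfolding blue_leg_nodes_def inner_faces_def by auto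
    then obtain d where d: "d \<in> f" "mobile_color rot uB uR out col d = Blue" "is_leg rot uB uR out d"
      unfolding leg_of_color_def by blast
    obtain x y where "d = (x, y)" by (cases d)
    then have xy: "(x, y) \<in> f" "mobile_color rot uB uR out col (x, y) = Blue" "ori rot uB uR out y x"
      using d by (simp_all add: is_leg_def)
    obtain a b where ab: "adj a b" "f = fc a b" using f(1) by (rule FsE)
    have a: "adj x y" and fxy: "fc x y = f" using fc_memD[OF ab(1)] xy(1) ab(2) by auto
    have "y \<in> insert uR inner \<and> pa y = x"
    proof (cases "x = uB")
      case True
      have "y \<noteq> uG" using xy(3) True outer_triangle(8,9,10) by (auto simp: ori_def outer_vs_eq)
      then have "y = uR \<or> y \<in> inner" using adjD[OF a] True by (auto simp: inner_def)
      then show ?thesis using child_uB[of y] a True pa_inner by (auto simp: child_def pa_def)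
    next
      case False
      let ?z = "rot y x"
      have c: "corner_color rot uB uR out col x ?z = Blue"
        using xy(2) by (simp add: mobile_color_def)
      then have x: "x \<in> inner" using False adjD(1)[OF a]
        by (auto simp: corner_color_def inner_def split: if_splits)
      have z: "adj x ?z" "rot x ?z = y" using triangle[OF a] by auto
      \<comment> \<open>A blue corner lies between the outgoing green and red edges. Its closing
        edge is thus \<open>In Blue\<close> or \<open>Out Red\<close>, and being a leg means that it
        is ingoing.\<close>
      have "lb x ?z = Out Green \<or> lb x ?z = In Blue"
        using c innerD[OF x] by (auto simp: corner_color_def split: if_splits lab.splits color.splits)
      then have "lb x y = In Blue \<or> lb x y = Out Red"
        using allowed[OF x z(1)] z(2) by auto
      moreover have "\<not> out x y" using xy(3) x ori_inner out_flip(1)[OF x a] by simp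
      ultimately have "lb x y = In Blue" by (auto simp: lab_def)
      then show ?thesis using In_inner[OF x a] pa_inner by blast
    qed
    then show "f \<in> (\<lambda>v. fc (pa v) v) ` insert uR inner" using fxy by blast
  qed
qed

text \<open>The vertex can be recovered from the face, which has only one blue dart.\<close>

lemma inj_blue_face:
  assumes ne: "inner \<noteq> {}"
  shows "inj_on (\<lambda>v. fc (pa v) v) (insert uR inner)"
proof (rule inj_onI)
  fix v v' assume v: "v \<in> insert uR inner" "v' \<in> insert uR inner" "fc (pa v) v = fc (pa v') v'"
  then have "(pa v', v') \<in> {(pa v, v), (v, third v), (third v, pa v)}"
    using fc_mem[OF adj_pa[OF v(2)]] face_eq[OF v(1)] by simp
  then show "v = v'"
    using face_colors[OF v(1) ne] face_colors(1)[OF v(2) ne] by auto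
qed

text \<open>The face would be bounded by the directed cycle \<open>v\<close>, \<open>pa v\<close>,
  \<open>third v\<close>. Its vertices are inner, because inner edges never leave \<open>uG\<close>
  or \<open>uB\<close> and \<open>green_leg_iff\<close> rules out \<open>uR\<close>.\<close>

lemma no_clockwise_face:
  assumes v: "v \<in> insert uR inner" and ne: "inner \<noteq> {}"
    and min: "\<not> (\<exists>cs. clockwise_cycle adj rot uB uR out cs)"
  shows "\<not> (ori rot uB uR out (third v) v \<and> ori rot uB uR out (pa v) (third v))"
proof
  assume o: "ori rot uB uR out (third v) v \<and> ori rot uB uR out (pa v) (third v)"
  note t = third_triangle[OF v]
  have "v \<noteq> uR" using o green_leg_iff[OF v ne] by blast
  then have vi: "v \<in> inner" using v by simp
  have ov: "out (third v) v" using o ori_inner vi by simp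
  have "third v \<noteq> uG" using ov to_outer(2)[OF vi] out_flip(1)[OF vi t(1)] t(1) by auto
  then have zi: "third v \<in> inner" using third_cases[OF v ne] by blast
  have oz: "out (pa v) (third v)" using o ori_inner zi by simp
  have "pa v \<noteq> uB" using oz to_outer(1)[OF zi] out_flip(1)[OF zi t(3)] t(3) by auto
  then have xi: "pa v \<in> inner" using pa_cases[OF vi] by blast
  have ox: "out v (pa v)" "adj v (pa v)" using par[OF vi] pa_inner[OF vi] by auto
  define cs where cs: "cs = [v, pa v, third v]"
  have len: "length cs = 3" by (simp add: cs)
  have nx: "rot (cs ! i) (cs ! (Suc i mod 3)) = cs ! ((i + 3 - 1) mod 3)"
    "face_of rot (cs ! (Suc i mod 3), cs ! i) = fc (pa v) v" if "i < 3" for i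
  proof -
    have i: "i = 0 \<or> i = 1 \<or> i = 2" using that by auto
    have "fc (third v) (pa v) = fc (pa v) v" "fc v (third v) = fc (pa v) v"
      using fc_memD(2)[OF adj_pa[OF v]] face_eq[OF v] by auto
    then show "rot (cs ! i) (cs ! (Suc i mod 3)) = cs ! ((i + 3 - 1) mod 3)"
      "face_of rot (cs ! (Suc i mod 3), cs ! i) = fc (pa v) v"
      using i t(5-7) unfolding cs by (elim disjE; simp)+
  qed
  \<comment> \<open>Each vertex of the triangle has a single right corner, and all edges of the face
    belong to the cycle, so the region cannot grow beyond that face.\<close>
  have region: "F = fc (pa v) v" if "F \<in> right_region rot cs" for F
    using that
  proof (induction rule: right_region.induct)
    case (corner a b)
    then obtain i j where ij: "i < 3" "a = cs ! i" "b = (rot a ^^ j) (cs ! (Suc i mod 3))"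
      "j < (LEAST m. 0 < m \<and> (rot a ^^ m) (cs ! (Suc i mod 3)) = cs ! ((i + 3 - 1) mod 3))"
      unfolding right_corners_def len by blast
    have "(LEAST m. 0 < m \<and> (rot a ^^ m) (cs ! (Suc i mod 3)) = cs ! ((i + 3 - 1) mod 3)) \<le> 1"
      by (rule Least_le) (use nx(1)[OF ij(1)] ij(2) in simp)
    then have "j = 0" using ij(4) by linarith
    then show ?case using nx(2)[OF ij(1)] ij(2,3) by simp
  next
    case (cross F a b)
    have ce: "cycle_edge cs (cs ! i) (cs ! (Suc i mod 3))" if "i < 3" for i
      unfolding cycle_edge_def len by (rule exI[of _ i]) (use that in simp)
    have comm: "cycle_edge cs y x" if "cycle_edge cs x y" for x y
      using that by (simp add: cycle_edge_def insert_commute)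
    have "cycle_edge cs a b"
    proof -
      have "cycle_edge cs v (pa v)" "cycle_edge cs (pa v) (third v)" "cycle_edge cs (third v) v"
        using ce[of 0] ce[of 1] ce[of 2] unfolding cs by simp_all
      then show ?thesis using cross face_eq[OF v] comm by auto
    qed
    then show ?case using cross by blast
  qed
  have "directed_cycle adj rot uB uR out cs"
  proof -
    have "v \<noteq> pa v" "pa v \<noteq> third v" "v \<noteq> third v" using adjD(3) ox t by auto
    moreover have "inner_edge adj rot uB uR (cs ! i) (cs ! (Suc i mod 3)) \<and> out (cs ! i) (cs ! (Suc i mod 3))"
      if "i < 3" for i
    proof -
      have i: "i = 0 \<or> i = 1 \<or> i = 2" using that by auto
      then show ?thesis using ov oz ox t(2,4) vi xi zi unfolding inner_edge_iff cs by (elim disjE; simp)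
    qed
    ultimately show ?thesis unfolding directed_cycle_def len by (simp add: cs)
  qed
  moreover have "outer_face rot uB uR \<notin> right_region rot cs"
  proof
    assume "outer_face rot uB uR \<in> right_region rot cs"
    then have "(pa v, v) \<in> outer_face rot uB uR" using region fc_mem[OF adj_pa[OF v]] by simp
    then show False using vi unfolding outer_face_eq by (auto simp: inner_def)
  qed
  ultimately show False using min unfolding clockwise_cycle_def by blast
qed

section \<open>The Bernardi--Bonichon map\<close>

lemma cw_next_uR: "cw_next T rot uR uB = uB"
proof -
  define nb where "nb = (\<lambda>j. (rot uR ^^ j) uB)"
  obtain d where d: "d > 0" "(rot uR ^^ d) uB = uB" "inj_on (\<lambda>j. (rot uR ^^ j) uB) {..<d}"
    by (rule nbr_enumeration[OF outer_triangle(1)])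
  have "(rot uR ^^ j) uB \<noteq> uB" if "0 < j" "j < d" for j
    using inj_onD[OF d(3), of j 0] that by auto
  then have "filter (\<lambda>j. T uR ((rot uR ^^ j) uB)) [1..<d] = []"
    using T_uR by (auto simp: filter_empty_conv)
  then have "filter (\<lambda>j. T uR ((rot uR ^^ j) uB)) [1..<Suc d] = [d]"
    using d(1,2) T_uR by simp
  then show ?thesis using cw_next_chain[OF d(1), of T uR uB] d(2) by simp
qed

lemma contour_walk:
  assumes "walk (cw_next Tr rot) ds" "hd ds = (uB, cw_next Tr rot uB uR)"
  shows "contour Tr rot uB uR (length ds) = ds"
  using walk_eq_iterate[of "\<lambda>(x, y). (y, cw_next Tr rot y x)" ds] assms
  by (simp add: contour_def case_prod_beta')

lemma bernardi_bonichon_tree: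
  assumes n: "card inner = n" "n \<ge> 1"
  obtains ts where "btree (Node uB ts)" "ts \<noteq> []" "set (concat (map preorder ts)) = inner"
    "distinct (concat (map preorder ts))" "length (concat (map preorder ts)) = n"
    "bb_lower adj rot uB uR out col n = concat (map tree_word ts)"
    "bb_vertices adj rot uB uR col n = concat (map preorder ts) @ [uR]"
proof -
  have ne: "inner \<noteq> {}" using n by auto
  obtain tB where tB: "btree tB" "rt_root tB = uB" using btree_exists[of uB] by blast
  then obtain ts where ts: "btree (Node uB ts)" by (cases tB) auto
  define vs where "vs = concat (map preorder ts)"
  define D where "D = concat (map (tour uB) ts)"
  have d: "distinct (uB # vs)" using distinct_preorder_btree[OF ts] unfolding vs_def by simp
  have "set (uB # vs) = insert uB inner"
  proof -
    have "(v, uB) \<in> childrel\<^sup>* \<longleftrightarrow> v \<in> insert uB inner" for v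
      using childrel_to_uB[of v] by (auto elim: converse_rtranclE simp: childrel_def child_def)
    then show ?thesis using set_preorder_btree[OF ts] unfolding vs_def by auto
  qed
  moreover have "uB \<notin> inner" "uR \<notin> inner" by (simp_all add: inner_def)
  ultimately have sv: "set vs = inner" using d by auto
  have dv: "distinct vs" using d by simp
  have lv: "length vs = n" using distinct_card[OF dv] sv n by simp
  have tne: "ts \<noteq> []" using sv ne unfolding vs_def by auto
  have lD: "length D = 2 * n" using length_tour_forest[of uB ts] lv unfolding D_def vs_def by simp
  then have Dne: "D \<noteq> []" using n by auto
  have gc: "good_children uB (map rt_root ts)" using ts by simp
  have roots: "rt_root t \<in> inner" "par Blue (rt_root t) = uB" "btree t" if "t \<in> set ts" for t
    using btree_roots[OF ts that] by (auto simp: child_def)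
  \<comment> \<open>\<open>(uR, uB)\<close> is not a dart of \<open>T0\<close>; it is put in front
    because the contour starts by turning at \<open>uB\<close> from \<open>uR\<close>. The last dart
    merely completes the shape required by \<open>walk_forest\<close>. Both are cut off in
    \<open>c0\<close>.\<close>
  have w0: "walk (cw_next T0 rot) ((uR, uB) # D @ [(uB, cw_next T0 rot uB (last (uR # map rt_root ts)))])"
    unfolding D_def
  proof (rule walk_forest)
    show "chained (cw_next T0 rot) uB t" if "t \<in> set ts" for t
      using chained_btree0[of t] roots[OF that] by simp
    have "successively (\<lambda>p q. cw_next T0 rot uB p = q) (uR # map rt_root ts)"
      using gc by (simp add: good_children_def start_def)
    then show "successively (\<lambda>p q. cw_next T0 rot uB p = q)
       (uR # map rt_root ts @ [cw_next T0 rot uB (last (uR # map rt_root ts))])"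
      unfolding append_Cons[symmetric] successively_append_iff by simp
  qed
  have w: "walk (cw_next T rot) ((uR, uB) # D @ [(uB, uR)])"
    unfolding D_def
  proof (rule walk_forest)
    show "chained (cw_next T rot) uB t" if "t \<in> set ts" for t
      using chained_btree[of t] roots[OF that] by simp
    show "successively (\<lambda>p q. cw_next T rot uB p = q) (uR # map rt_root ts @ [uR])"
      using gc by (simp add: good_children_def start_def)
  qed
  have c0: "contour T0 rot uB uR (2 * n) = D"
  proof -
    have "walk (cw_next T0 rot) D" "hd D = (uB, cw_next T0 rot uB uR)"
      using w0 Dne by (auto simp: successively_Cons successively_append_iff)
    from contour_walk[OF this] show ?thesis unfolding lD .
  qed
  \<comment> \<open>Two more steps than for \<open>T0\<close>: to the leaf \<open>uR\<close> and
    back.\<close>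
  have c: "contour T rot uB uR (2 * (n + 1)) = D @ [(uB, uR), (uR, uB)]"
  proof -
    have "walk (cw_next T rot) (D @ [(uB, uR), (uR, uB)])"
      using w Dne cw_next_uR by (auto simp: successively_Cons successively_append_iff)
    moreover have "hd (D @ [(uB, uR), (uR, uB)]) = (uB, cw_next T rot uB uR)"
      using w Dne by (auto simp: successively_Cons)
    ultimately have "contour T rot uB uR (length (D @ [(uB, uR), (uR, uB)])) = D @ [(uB, uR), (uR, uB)]"
      by (rule contour_walk)
    then show ?thesis using lD by simp
  qed
  have "map (step_letter adj rot uB uR out col) D = concat (map tree_word ts)"
    unfolding D_def map_concat map_map comp_def
    using tour_word roots by (intro arg_cong[where f = concat] map_cong) auto
  then have lower: "bb_lower adj rot uB uR out col n = concat (map tree_word ts)"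
    unfolding bb_lower_def c0 .
  have "bb_vertices adj rot uB uR col n =
      filter (\<lambda>v. v \<noteq> uB) (firsts ((([uB] @ map snd D) @ [uR]) @ [uB]))"
    unfolding bb_vertices_def c firsts_def by simp
  also have "firsts ((([uB] @ map snd D) @ [uR]) @ [uB]) = firsts ([uB] @ map snd D) @ [uR]"
  proof -
    have "snd ` set D \<subseteq> insert uB (set vs)" unfolding D_def vs_def by (auto simp: image_UN snd_tour)
    then have "uR \<notin> set ([uB] @ map snd D)" using sv \<open>uR \<notin> inner\<close> outer_triangle(8) by auto
    then show ?thesis
      using firsts_snoc[of "([uB] @ map snd D) @ [uR]" uB] firsts_snoc[of "[uB] @ map snd D" uR] by simp
  qed
  also have "firsts ([uB] @ map snd D) = uB # vs"
    unfolding D_def vs_def using d firsts_tour_forest[of uB "[uB]" ts]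
    by (simp add: vs_def firsts_def)
  also have "filter (\<lambda>v. v \<noteq> uB) ((uB # vs) @ [uR]) = vs @ [uR]"
  proof -
    have "filter (\<lambda>v. v \<noteq> uB) vs = vs" using d by (intro filter_True) auto
    then show "filter (\<lambda>v. v \<noteq> uB) ((uB # vs) @ [uR]) = vs @ [uR]" using outer_triangle(8) by simp
  qed
  finally have "bb_vertices adj rot uB uR col n = vs @ [uR]" .
  then show thesis using that ts tne sv dv lv lower unfolding vs_def by blast
qed

section \<open>The type-preserving bijection\<close>

lemma blue_leg_bijection:
  assumes n: "card inner = n" "n \<ge> 1"
    and min: "\<not> (\<exists>cs. clockwise_cycle adj rot uB uR out cs)"
  shows "\<exists>g. bij_betw g {0..n} (blue_leg_nodes adj rot uB uR out col) \<and>
    (\<forall>r \<le> n. node_has_type rot uB uR out col (g r)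
      (position_type (bb_lower adj rot uB uR out col n) (bb_upper adj rot uB uR out col n) r))"
proof -
  have ne: "inner \<noteq> {}" using n by auto
  obtain ts where ts: "btree (Node uB ts)" "ts \<noteq> []" "set (concat (map preorder ts)) = inner"
    "distinct (concat (map preorder ts))" "length (concat (map preorder ts)) = n"
    "bb_lower adj rot uB uR out col n = concat (map tree_word ts)"
    "bb_vertices adj rot uB uR col n = concat (map preorder ts) @ [uR]"
    by (rule bernardi_bonichon_tree[OF n])
  define vs where "vs = concat (map preorder ts) @ [uR]"
  have uRi: "uR \<notin> inner" by (simp add: inner_def)
  have vs: "distinct vs" "set vs = insert uR inner" "length vs = Suc n"
    using ts(3-5) uRi unfolding vs_def by auto
  have mem: "vs ! r \<in> insert uR inner" if "r \<le> n" for r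
    using nth_mem[of r vs] vs that by simp
  define g where "g r = fc (pa (vs ! r)) (vs ! r)" for r
  have "bij_betw ((!) vs) {0..n} (insert uR inner)"
    using bij_betw_nth[OF vs(1), of "{0..n}" "insert uR inner"] vs by (simp add: atLeast0AtMost lessThan_Suc_atMost)
  moreover have "bij_betw (\<lambda>v. fc (pa v) v) (insert uR inner) (blue_leg_nodes adj rot uB uR out col)"
    unfolding bij_betw_def using inj_blue_face[OF ne] blue_leg_nodes_eq[OF ne] by simp
  ultimately have bij: "bij_betw g {0..n} (blue_leg_nodes adj rot uB uR out col)"
    using bij_betw_trans unfolding g_def comp_def by fastforce
  have lower: "canopy (bb_lower adj rot uB uR out col n) ! r = E \<longleftrightarrow> vs ! r \<noteq> uR \<and> first_child (vs ! r)"
    if r: "r \<le> n" for r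
  proof -
    let ?w = "bb_lower adj rot uB uR out col n"
    have z: "zero_runs ?w = map first_child (concat (map preorder ts)) @ [False]"
      using zero_runs_forest[OF well_flagged_btree[OF ts(1)]] ts(2,6) by simp
    have "canopy ?w ! r = E \<longleftrightarrow> zero_runs ?w ! r"
      using canopy_nth[of r ?w] r z ts(5) by simp
    also have "\<dots> \<longleftrightarrow> vs ! r \<noteq> uR \<and> first_child (vs ! r)"
    proof (cases "r < n")
      case True
      then have "concat (map preorder ts) ! r \<in> inner" using ts(3,5) nth_mem by metis
      then show ?thesis using True uRi ts(5) unfolding z vs_def by (auto simp: nth_append)
    next
      case False
      then show ?thesis using r ts(5) unfolding z vs_def by (simp add: nth_append)
    qed
    finally show ?thesis .
  qed
  have upper: "canopy (bb_upper adj rot uB uR out col n) ! r = (if r = 0 \<or> red_in (vs ! r) = {} then E else N)"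
    if r: "r \<le> n" for r
  proof -
    have "bb_upper adj rot uB uR out col n =
        concat (map (\<lambda>r. N # replicate (card (red_in (vs ! r))) E) [1..<n + 1])"
      unfolding bb_upper_def ts(7) vs_def[symmetric] red_in_def ..
    \<comment> \<open>The leading 0 is the empty run before the first \<open>N\<close>; it shifts
      the list \<open>[1..<n + 1]\<close> so that the entry of \<open>r\<close> stands at position
      \<open>r\<close>.\<close>
    then have e: "eruns (bb_upper adj rot uB uR out col n) = 0 # map (\<lambda>r. card (red_in (vs ! r))) [1..<n + 1]"
      by (simp only: eruns_concat)
    have fin: "finite (red_in v)" for v
      by (rule finite_subset[OF _ finite_V]) (auto simp: red_in_def inner_edge_iff dest: adjD)
    show ?thesis
    proof (cases r)
      case 0
      then show ?thesis unfolding canopy_def e by simp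
    next
      case (Suc k)
      then have "eruns (bb_upper adj rot uB uR out col n) ! r = card (red_in (vs ! r))"
        using r unfolding e by (simp del: upt_Suc)
      moreover have "r < length (eruns (bb_upper adj rot uB uR out col n))" using r unfolding e by simp
      ultimately show ?thesis using Suc fin unfolding canopy_def by simp
    qed
  qed
  have "node_has_type rot uB uR out col (g r)
      (position_type (bb_lower adj rot uB uR out col n) (bb_upper adj rot uB uR out col n) r)"
    if r: "r \<le> n" for r
  proof -
    let ?v = "vs ! r"
    note v = mem[OF r]
    note legs = face_legs[OF v ne, folded g_def]
    have red: "leg_of_color rot uB uR out col (g r) Red \<longleftrightarrow> red_in ?v \<noteq> {}"
      using legs red_leg_iff[OF v ne] by simp
    have green: "leg_of_color rot uB uR out col (g r) Green \<longleftrightarrow>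
        canopy (bb_lower adj rot uB uR out col n) ! r = E"
      using legs green_leg_iff[OF v ne] lower[OF r] by simp
    have excl: "\<not> (leg_of_color rot uB uR out col (g r) Red \<and> leg_of_color rot uB uR out col (g r) Green)"
      using legs no_clockwise_face[OF v ne min] by simp
    \<comment> \<open>At position 0 the upper letter is \<open>E\<close> without regard to
      \<open>red_in\<close>; the green leg found here, together with \<open>excl\<close>, shows that
      there is no red leg either.\<close>
    have zero: "leg_of_color rot uB uR out col (g r) Green" if "r = 0"
    proof -
      have "zero_runs (bb_lower adj rot uB uR out col n) ! 0"
        using ts(2,6) by (cases ts; cases "hd ts") (auto simp: zero_runs_def)
      then have "canopy (bb_lower adj rot uB uR out col n) ! 0 = E"
        using canopy_nth[of 0 "bb_lower adj rot uB uR out col n"] by (auto simp: zero_runs_def)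
      then show ?thesis using green that by simp
    qed
    show ?thesis
      using legs(1) red green excl zero upper[OF r] letter.exhaust[of "canopy (bb_lower adj rot uB uR out col n) ! r"]
      unfolding node_has_type_def position_type_def by (auto split: if_splits)
  qed
  then show ?thesis using bij by blast
qed

end

theorem theorem2:
  fixes V :: "'v set" and adj :: "'v \<Rightarrow> 'v \<Rightarrow> bool" and rot :: "'v \<Rightarrow> 'v \<Rightarrow> 'v"
    and uB uR :: 'v and out :: "'v \<Rightarrow> 'v \<Rightarrow> bool" and col :: "'v \<Rightarrow> 'v \<Rightarrow> color"
    and n :: nat
  assumes "n \<ge> 1"
    and "rooted_triangulation V adj rot uB uR"
    and "card V = n + 3"
    and "minimal_schnyder_wood V adj rot uB uR out col"
  shows "\<exists>g. bij_betw g {0..n} (blue_leg_nodes adj rot uB uR out col) \<and>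
             (\<forall>r \<le> n. node_has_type rot uB uR out col (g r)
                (position_type (bb_lower adj rot uB uR out col n) (bb_upper adj rot uB uR out col n) r))"
proof -
  interpret schnyder_map V adj rot uB uR out col
    using assms(2,4) by unfold_locales (auto simp: rooted_triangulation_def minimal_schnyder_wood_def)
  have "card inner = card V - card {uB, rot uB uR, uR}"
    unfolding inner_def using outer_in_V by (intro card_Diff_subset) auto
  also have "card {uB, rot uB uR, uR} = 3" using outer_triangle by auto
  finally have "card inner = n" using assms(3) by simp
  then show ?thesis
    using blue_leg_bijection[of n] assms(1,4) unfolding minimal_schnyder_wood_def by blast
qed

end
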